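(* Let $F$ be an algebraically closed field, $H$ a subgroup of a discrete finitely generated group $G$ such that $\mathrm{Ind}_H^G$ is an exact functor, and $\rho$ a finite-dimensional representation of $G$ over $F$. If $\rho$ is $\mathrm{Ind}_H^G(\mathrm{Res}_H^G(\rho))$-injective and $\mathrm{End}_H(\mathrm{Res}_H^G(\rho))$ is commutative, then $\mathrm{Res}_H^G(\rho)$ is multiplicity-free.
   Context: $\mathrm{Res}_H^G$ is restriction from representations of $G$ over $F$ ($F[G]$-modules) to representations of $H$ over $F$ ($F[H]$-modules), and $\mathrm{Ind}_H^G$ is its left adjoint, $\mathrm{Ind}_H^G(M)=F[G]\otimes_{F[H]}M$. For a ring $R$ with unity and $R$-modules $M,N$, $M$ is $N$-injective if for every $R$-module $K$, every injective homomorphism $f:K\hookrightarrow N$ and every homomorphism $g:K\to M$, there is a homomorphism $h:N\to M$ with $h\circ f=g$. Here this is applied with $R=F[G]$. A representation $\sigma$ of $H$ over $F$ is multiplicity-free if $\dim_F\mathrm{Hom}_H(\pi,\sigma)\le 1$ for all irreducible representations $\pi$ of $H$ over $F$. *)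

theory Defs
  imports
    "HOL-Algebra.Algebraic_Closure"
    "HOL-Algebra.Free_Abelian_Groups"
    "Jordan_Normal_Form.Missing_VectorSpace"
begin

section \<open>Modules over a not necessarily commutative ring\<close>

text \<open>The locale \<^locale>\<open>module\<close> of HOL-Algebra requires a commutative ring of scalars. The locale
  below reuses its record type for unital left modules over an arbitrary ring with one; as there,
  the fields \<open>mult\<close> and \<open>one\<close> of the module record carry no meaning.\<close>

locale left_module = R?: ring R + M?: abelian_group M
  for R :: "('r, 'x) ring_scheme" (structure) and M :: "('r, 'm, 'y) module_scheme" (structure) +
  assumes smult_closed: "\<lbrakk>r \<in> carrier R; x \<in> carrier M\<rbrakk> \<Longrightarrow> r \<odot>\<^bsub>M\<^esub> x \<in> carrier M"
    and smult_l_distr: "\<lbrakk>r \<in> carrier R; s \<in> carrier R; x \<in> carrier M\<rbrakk>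
      \<Longrightarrow> (r \<oplus> s) \<odot>\<^bsub>M\<^esub> x = r \<odot>\<^bsub>M\<^esub> x \<oplus>\<^bsub>M\<^esub> s \<odot>\<^bsub>M\<^esub> x"
    and smult_r_distr: "\<lbrakk>r \<in> carrier R; x \<in> carrier M; y \<in> carrier M\<rbrakk>
      \<Longrightarrow> r \<odot>\<^bsub>M\<^esub> (x \<oplus>\<^bsub>M\<^esub> y) = r \<odot>\<^bsub>M\<^esub> x \<oplus>\<^bsub>M\<^esub> r \<odot>\<^bsub>M\<^esub> y"
    and smult_assoc1: "\<lbrakk>r \<in> carrier R; s \<in> carrier R; x \<in> carrier M\<rbrakk>
      \<Longrightarrow> (r \<otimes> s) \<odot>\<^bsub>M\<^esub> x = r \<odot>\<^bsub>M\<^esub> (s \<odot>\<^bsub>M\<^esub> x)"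
    and smult_one: "x \<in> carrier M \<Longrightarrow> \<one> \<odot>\<^bsub>M\<^esub> x = x"

text \<open>The name \<open>submodule\<close> is qualified because the AFP theory of vector spaces introduces a second
  constant of that name, which is restricted to commutative rings.\<close>

definition simple_module :: "('r, 'x) ring_scheme \<Rightarrow> ('r, 'm) module \<Rightarrow> bool" where
  "simple_module R M \<longleftrightarrow> left_module R M \<and> carrier M \<noteq> {\<zero>\<^bsub>M\<^esub>} \<and>
     (\<forall>N. Module.submodule N R M \<longrightarrow> N = {\<zero>\<^bsub>M\<^esub>} \<or> N = carrier M)"

text \<open>\<open>M\<close> is \<open>N\<close>-injective. An \<open>R\<close>-module that embeds into \<open>N\<close> is isomorphic to one carried by a
  subset of the carrier of \<open>N\<close>, so letting \<open>K\<close> range over the modules with elements of the type of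
  those of \<open>N\<close> is no restriction.\<close>

definition relatively_injective ::
  "('r, 'x) ring_scheme \<Rightarrow> ('r, 'm) module \<Rightarrow> ('r, 'n) module \<Rightarrow> bool" where
  "relatively_injective R M N \<longleftrightarrow>
     (\<forall>(K :: ('r, 'n) module) f g.
        left_module R K \<longrightarrow> f \<in> module_hom R K N \<longrightarrow> inj_on f (carrier K) \<longrightarrow> g \<in> module_hom R K M
        \<longrightarrow> (\<exists>h \<in> module_hom R N M. \<forall>x \<in> carrier K. h (f x) = g x))"

definition short_exact ::
  "('r, 'x) ring_scheme \<Rightarrow> ('r, 'a) module \<Rightarrow> ('r, 'b) module \<Rightarrow> ('r, 'c) module
     \<Rightarrow> ('a \<Rightarrow> 'b) \<Rightarrow> ('b \<Rightarrow> 'c) \<Rightarrow> bool" where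
  "short_exact R A B C f g \<longleftrightarrow>
     left_module R A \<and> left_module R B \<and> left_module R C \<and>
     f \<in> module_hom R A B \<and> g \<in> module_hom R B C \<and>
     inj_on f (carrier A) \<and> f ` carrier A = a_kernel B C g \<and> g ` carrier B = carrier C"

text \<open>Homomorphisms are represented by their unique extensional representatives, so that equality
  in the endomorphism ring is equality of maps on the carrier.\<close>

definition End_ring :: "('r, 'x) ring_scheme \<Rightarrow> ('r, 'm) module \<Rightarrow> ('m \<Rightarrow> 'm) ring" where
  "End_ring R M =
     \<lparr>carrier = module_hom R M M \<inter> extensional (carrier M),
      monoid.mult = compose (carrier M),
      one = (\<lambda>x \<in> carrier M. x),
      ring.zero = (\<lambda>x \<in> carrier M. \<zero>\<^bsub>M\<^esub>),
      ring.add = (\<lambda>f g. \<lambda>x \<in> carrier M. f x \<oplus>\<^bsub>M\<^esub> g x)\<rparr>"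


section \<open>Change of rings\<close>

definition restrict_scalars :: "('r \<Rightarrow> 's) \<Rightarrow> ('s, 'm) module \<Rightarrow> ('r, 'm) module" where
  "restrict_scalars \<phi> M =
     \<lparr>carrier = carrier M, monoid.mult = monoid.mult M, one = one M, ring.zero = ring.zero M, ring.add = ring.add M,
      smult = (\<lambda>r x. \<phi> r \<odot>\<^bsub>M\<^esub> x)\<rparr>"

text \<open>For a ring homomorphism \<open>\<phi>\<close> from \<open>R\<close> to \<open>S\<close>, the left \<open>S\<close>-module \<open>S \<otimes>\<^sub>R M\<close>: the free abelian
  group on the pairs \<open>(s, x)\<close>, modulo the subgroup generated by the relations that make
  \<open>(s, x) \<mapsto> s \<otimes> x\<close> biadditive and \<open>R\<close>-balanced, where \<open>R\<close> acts on \<open>S\<close> from the right via \<open>\<phi>\<close>.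
  Its elements are the cosets of that subgroup.\<close>

definition tensor_relations ::
  "('r, 'x) ring_scheme \<Rightarrow> ('s, 'y) ring_scheme \<Rightarrow> ('r \<Rightarrow> 's) \<Rightarrow> ('r, 'm) module
     \<Rightarrow> ('s \<times> 'm \<Rightarrow>\<^sub>0 int) set" where
  "tensor_relations R S \<phi> M =
     {frag_of (s \<oplus>\<^bsub>S\<^esub> t, x) - frag_of (s, x) - frag_of (t, x) |s t x.
        s \<in> carrier S \<and> t \<in> carrier S \<and> x \<in> carrier M} \<union>
     {frag_of (s, x \<oplus>\<^bsub>M\<^esub> y) - frag_of (s, x) - frag_of (s, y) |s x y.
        s \<in> carrier S \<and> x \<in> carrier M \<and> y \<in> carrier M} \<union>
     {frag_of (s \<otimes>\<^bsub>S\<^esub> \<phi> r, x) - frag_of (s, r \<odot>\<^bsub>M\<^esub> x) |s r x.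
        s \<in> carrier S \<and> r \<in> carrier R \<and> x \<in> carrier M}"

definition tensor_null ::
  "('r, 'x) ring_scheme \<Rightarrow> ('s, 'y) ring_scheme \<Rightarrow> ('r \<Rightarrow> 's) \<Rightarrow> ('r, 'm) module
     \<Rightarrow> ('s \<times> 'm \<Rightarrow>\<^sub>0 int) set" where
  "tensor_null R S \<phi> M =
     generate (free_Abelian_group (carrier S \<times> carrier M)) (tensor_relations R S \<phi> M)"

definition tensor_class ::
  "('r, 'x) ring_scheme \<Rightarrow> ('s, 'y) ring_scheme \<Rightarrow> ('r \<Rightarrow> 's) \<Rightarrow> ('r, 'm) module
     \<Rightarrow> ('s \<times> 'm \<Rightarrow>\<^sub>0 int) \<Rightarrow> ('s \<times> 'm \<Rightarrow>\<^sub>0 int) set" where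
  "tensor_class R S \<phi> M c =
     tensor_null R S \<phi> M #>\<^bsub>free_Abelian_group (carrier S \<times> carrier M)\<^esub> c"

text \<open>In \<open>smult\<close> below, and in \<open>extend_scalars_map\<close>, all representatives \<open>c\<close> of the coset \<open>U\<close> yield
  the same coset, so the union is the image of \<open>U\<close> under the induced map on the quotient;
  \<^const>\<open>frag_extend\<close> is the \<open>\<int>\<close>-linear extension of a map on generators.\<close>

definition extend_scalars ::
  "('r, 'x) ring_scheme \<Rightarrow> ('s, 'y) ring_scheme \<Rightarrow> ('r \<Rightarrow> 's) \<Rightarrow> ('r, 'm) module
     \<Rightarrow> ('s, ('s \<times> 'm \<Rightarrow>\<^sub>0 int) set) module" where
  "extend_scalars R S \<phi> M =
     (let Q = free_Abelian_group (carrier S \<times> carrier M) Mod tensor_null R S \<phi> M in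
      \<lparr>carrier = carrier Q, monoid.mult = monoid.mult Q, one = one Q, ring.zero = one Q, ring.add = monoid.mult Q,
       smult = (\<lambda>s U. \<Union>c \<in> U. tensor_class R S \<phi> M
                  (frag_extend (\<lambda>(t, x). frag_of (s \<otimes>\<^bsub>S\<^esub> t, x)) c))\<rparr>)"

text \<open>The map \<open>s \<otimes> x \<mapsto> s \<otimes> f x\<close> induced by a homomorphism \<open>f\<close> with codomain \<open>M'\<close>.\<close>

definition extend_scalars_map ::
  "('r, 'x) ring_scheme \<Rightarrow> ('s, 'y) ring_scheme \<Rightarrow> ('r \<Rightarrow> 's) \<Rightarrow> ('r, 'n) module \<Rightarrow> ('m \<Rightarrow> 'n)
     \<Rightarrow> ('s \<times> 'm \<Rightarrow>\<^sub>0 int) set \<Rightarrow> ('s \<times> 'n \<Rightarrow>\<^sub>0 int) set" where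
  "extend_scalars_map R S \<phi> M' f U =
     (\<Union>c \<in> U. tensor_class R S \<phi> M' (frag_extend (\<lambda>(s, x). frag_of (s, f x)) c))"


section \<open>Representations of groups\<close>

definition finitely_generated_group :: "('g, 'y) monoid_scheme \<Rightarrow> bool" where
  "finitely_generated_group G \<longleftrightarrow> (\<exists>S. finite S \<and> S \<subseteq> carrier G \<and> generate G S = carrier G)"

text \<open>Elements of the group ring are finitely supported functions that vanish off the carrier of the
  group; the product is convolution, \<open>(a b)(g) = \<Sum>\<^sub>x a(x) b(x\<inverse> g)\<close>. For a subgroup \<open>H\<close> of \<open>G\<close>, the
  elements of \<open>F[H]\<close> are thus literally the elements of \<open>F[G]\<close> that are supported on \<open>H\<close>, and the
  inclusion of \<open>F[H]\<close> into \<open>F[G]\<close> is the identity function.\<close>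

definition group_ring :: "('f, 'x) ring_scheme \<Rightarrow> ('g, 'y) monoid_scheme \<Rightarrow> ('g \<Rightarrow> 'f) ring" where
  "group_ring F G =
     \<lparr>carrier = {a. (\<forall>g \<in> carrier G. a g \<in> carrier F) \<and> (\<forall>g. g \<notin> carrier G \<longrightarrow> a g = \<zero>\<^bsub>F\<^esub>) \<and>
                    finite {g \<in> carrier G. a g \<noteq> \<zero>\<^bsub>F\<^esub>}},
      monoid.mult = (\<lambda>a b g. if g \<in> carrier G
                then (\<Oplus>\<^bsub>F\<^esub>x \<in> {x \<in> carrier G. a x \<noteq> \<zero>\<^bsub>F\<^esub>}. a x \<otimes>\<^bsub>F\<^esub> b (inv\<^bsub>G\<^esub> x \<otimes>\<^bsub>G\<^esub> g))
                else \<zero>\<^bsub>F\<^esub>),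
      one = (\<lambda>g. if g = \<one>\<^bsub>G\<^esub> then \<one>\<^bsub>F\<^esub> else \<zero>\<^bsub>F\<^esub>),
      ring.zero = (\<lambda>g. \<zero>\<^bsub>F\<^esub>),
      ring.add = (\<lambda>a b g. a g \<oplus>\<^bsub>F\<^esub> b g)\<rparr>"

definition group_ring_const ::
  "('f, 'x) ring_scheme \<Rightarrow> ('g, 'y) monoid_scheme \<Rightarrow> 'f \<Rightarrow> ('g \<Rightarrow> 'f)" where
  "group_ring_const F G c = (\<lambda>g. if g = \<one>\<^bsub>G\<^esub> then c else \<zero>\<^bsub>F\<^esub>)"

abbreviation subgroup_ring ::
  "('f, 'x) ring_scheme \<Rightarrow> ('g, 'y) monoid_scheme \<Rightarrow> 'g set \<Rightarrow> ('g \<Rightarrow> 'f) ring" where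
  "subgroup_ring F G H \<equiv> group_ring F (G\<lparr>carrier := H\<rparr>)"

abbreviation representation ::
  "('f, 'x) ring_scheme \<Rightarrow> ('g, 'y) monoid_scheme \<Rightarrow> ('g \<Rightarrow> 'f, 'v) module \<Rightarrow> bool" where
  "representation F G V \<equiv> left_module (group_ring F G) V"

definition underlying_space ::
  "('f, 'x) ring_scheme \<Rightarrow> ('g, 'y) monoid_scheme \<Rightarrow> ('g \<Rightarrow> 'f, 'v) module \<Rightarrow> ('f, 'v) module" where
  "underlying_space F G V = restrict_scalars (group_ring_const F G) V"

definition finite_dimensional_rep ::
  "('f, 'x) ring_scheme \<Rightarrow> ('g, 'y) monoid_scheme \<Rightarrow> ('g \<Rightarrow> 'f, 'v) module \<Rightarrow> bool" where
  "finite_dimensional_rep F G V \<longleftrightarrow>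
     representation F G V \<and> vectorspace.fin_dim F (underlying_space F G V)"

definition Res :: "('g \<Rightarrow> 'f, 'v) module \<Rightarrow> ('g \<Rightarrow> 'f, 'v) module" where
  "Res V = restrict_scalars (\<lambda>a. a) V"

definition Ind ::
  "('f, 'x) ring_scheme \<Rightarrow> ('g, 'y) monoid_scheme \<Rightarrow> 'g set \<Rightarrow> ('g \<Rightarrow> 'f, 'v) module
     \<Rightarrow> ('g \<Rightarrow> 'f, (('g \<Rightarrow> 'f) \<times> 'v \<Rightarrow>\<^sub>0 int) set) module" where
  "Ind F G H V = extend_scalars (subgroup_ring F G H) (group_ring F G) (\<lambda>a. a) V"

definition Ind_map ::
  "('f, 'x) ring_scheme \<Rightarrow> ('g, 'y) monoid_scheme \<Rightarrow> 'g set \<Rightarrow> ('g \<Rightarrow> 'f, 'w) module \<Rightarrow> ('v \<Rightarrow> 'w)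
     \<Rightarrow> (('g \<Rightarrow> 'f) \<times> 'v \<Rightarrow>\<^sub>0 int) set \<Rightarrow> (('g \<Rightarrow> 'f) \<times> 'w \<Rightarrow>\<^sub>0 int) set" where
  "Ind_map F G H W f = extend_scalars_map (subgroup_ring F G H) (group_ring F G) (\<lambda>a. a) W f"

text \<open>Exactness of \<open>Ind\<close> on the representations of \<open>H\<close> with elements in the type \<open>'v\<close>. HOL cannot
  quantify over all types inside a formula; as a hypothesis, exactness at one type is implied by
  exactness on all representations.\<close>

definition Ind_exact ::
  "'v itself \<Rightarrow> ('f, 'x) ring_scheme \<Rightarrow> ('g, 'y) monoid_scheme \<Rightarrow> 'g set \<Rightarrow> bool" where
  "Ind_exact T F G H \<longleftrightarrow>
     (\<forall>(A :: ('g \<Rightarrow> 'f, 'v) module) (B :: ('g \<Rightarrow> 'f, 'v) module) (C :: ('g \<Rightarrow> 'f, 'v) module) f g.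
        short_exact (subgroup_ring F G H) A B C f g \<longrightarrow>
        short_exact (group_ring F G) (Ind F G H A) (Ind F G H B) (Ind F G H C)
          (Ind_map F G H B f) (Ind_map F G H C g))"

definition Hom_space ::
  "('f, 'x) ring_scheme \<Rightarrow> ('g, 'y) monoid_scheme \<Rightarrow> ('g \<Rightarrow> 'f, 'v) module \<Rightarrow> ('g \<Rightarrow> 'f, 'w) module
     \<Rightarrow> ('f, 'v \<Rightarrow> 'w) module" where
  "Hom_space F G V W =
     \<lparr>carrier = module_hom (group_ring F G) V W \<inter> extensional (carrier V),
      monoid.mult = (\<lambda>f g. \<lambda>x \<in> carrier V. \<zero>\<^bsub>W\<^esub>),
      one = (\<lambda>x \<in> carrier V. \<zero>\<^bsub>W\<^esub>),
      ring.zero = (\<lambda>x \<in> carrier V. \<zero>\<^bsub>W\<^esub>),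
      ring.add = (\<lambda>f g. \<lambda>x \<in> carrier V. f x \<oplus>\<^bsub>W\<^esub> g x),
      smult = (\<lambda>c f. \<lambda>x \<in> carrier V. c \<odot>\<^bsub>underlying_space F G W\<^esub> f x)\<rparr>"

text \<open>The irreducible representations \<open>\<pi>\<close> range over those with elements in the type \<open>'p\<close>; a theorem
  that concludes this for a free type variable \<open>'p\<close> covers all of them. \<^const>\<open>vectorspace.dim\<close> is
  unspecified on spaces that are not finite-dimensional, whence the first conjunct.\<close>

definition multiplicity_free ::
  "'p itself \<Rightarrow> ('f, 'x) ring_scheme \<Rightarrow> ('g, 'y) monoid_scheme \<Rightarrow> ('g \<Rightarrow> 'f, 'v) module \<Rightarrow> bool" where
  "multiplicity_free T F G \<sigma> \<longleftrightarrow>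
     (\<forall>\<pi> :: ('g \<Rightarrow> 'f, 'p) module. simple_module (group_ring F G) \<pi> \<longrightarrow>
        vectorspace.fin_dim F (Hom_space F G \<pi> \<sigma>) \<and>
        vectorspace.dim F (Hom_space F G \<pi> \<sigma>) \<le> 1)"

end

theory Submission
  imports Defs
begin

text \<open>Let \<open>V = Res \<rho>\<close>. By Frobenius reciprocity and exactness of \<open>Ind\<close>, the injectivity hypothesis says
  that \<open>V\<close> is \<open>V\<close>-injective: every \<open>H\<close>-homomorphism from a submodule of \<open>V\<close> to \<open>V\<close> extends to an
  endomorphism of \<open>V\<close>. Let \<open>f\<close>, \<open>g\<close> be homomorphisms from an irreducible \<open>\<pi>\<close> to \<open>V\<close> with \<open>f \<noteq> 0\<close>, and
  extend \<open>f x \<mapsto> g x\<close> to an endomorphism \<open>T\<close>. If \<open>f \<pi>\<close> and \<open>g \<pi>\<close> meet trivially, extend the projection of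
  \<open>f \<pi> \<oplus> g \<pi>\<close> onto \<open>f \<pi>\<close> to an endomorphism \<open>B\<close>; then \<open>g = T B f = B T f = B g = 0\<close> by commutativity.
  Otherwise \<open>g \<pi> \<subseteq> f \<pi>\<close>, so \<open>T\<close> has an eigenvector \<open>f z\<close> in the finite-dimensional space \<open>f \<pi>\<close>, with
  eigenvalue \<open>c\<close> say; now \<open>g - c f\<close> kills \<open>z\<close>, hence all of \<open>\<pi>\<close>.\<close>

section \<open>Eigenvectors in invariant subspaces\<close>

text \<open>Frobenius reciprocity works as follows. A map from \<open>K\<close> to \<open>V\<close>
  is to be extended along an embedding of \<open>K\<close> into \<open>V\<close>. Its adjoint maps
  \<open>Ind K\<close> to \<rho>; this is extended to \<open>Ind V\<close>, and the extension is
  restricted to the elements 1 \<otimes> x. Exactness supplies the injectivity of the map from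
  \<open>Ind K\<close> to \<open>Ind V\<close>. The hypothesis speaks only of short exact sequences
  whose three terms have elements in one type, so the embedding must be completed by a cokernel
  inside the type of \<open>V\<close>.

  The alternative between trivial intersection and inclusion comes from simplicity: the x with g x
  in f \<pi> form a submodule of \<pi>, hence 0 or everything. Nothing is known about the dimension
  of \<pi>, so the eigenvector is sought in its image inside \<open>V\<close>. That
  \<open>g - c f\<close> is again a homomorphism, so that its kernel is a submodule, rests on the
  scalars being central in the group ring.

  That \<open>group_ring F G\<close> is a ring is part of \<rho> being a module over it, and the
  group ring of \<open>H\<close> inherits this as a subring.\<close>

lemma (in ring) eval_rev_upt:
  fixes c :: "nat \<Rightarrow> 'a" and n :: nat
  assumes "c \<in> {..<n} \<rightarrow> carrier R" "r \<in> carrier R"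
  shows "eval (map c (rev [0..<n])) r = (\<Oplus>i\<in>{..<n}. c i \<otimes> r [^] i)"
  using assms(1)
proof (induction n)
  case (Suc n)
  have *: "c \<in> {..<n} \<rightarrow> carrier R" "c n \<in> carrier R" using Suc.prems by auto
  then have "(\<Oplus>i\<in>{..<Suc n}. c i \<otimes> r [^] i) = c n \<otimes> r [^] n \<oplus> (\<Oplus>i\<in>{..<n}. c i \<otimes> r [^] i)"
    using assms(2) unfolding lessThan_Suc by (intro finsum_insert) auto
  then show ?case using Suc.IH[OF *(1)] by simp
qed simp

text \<open>The polynomial X^n - sum c_i X^i splits, so it has n roots with multiplicity, and at
  least one as n > 0. The equation is kept in the shape of the linear relation that will express T^n
  x through lower iterates.\<close>

lemma (in algebraically_closed) monic_root_exists:
  fixes c :: "nat \<Rightarrow> 'a" and n :: nat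
  assumes "c \<in> {..<n} \<rightarrow> carrier L" "n > 0"
  obtains r where "r \<in> carrier L" "r [^] n = (\<Oplus>i\<in>{..<n}. c i \<otimes> r [^] i)"
proof -
  define d where "d i = (if i = n then \<one> else \<ominus> c i)" for i
  have d: "d \<in> {..<n} \<rightarrow> carrier L" "d n = \<one>" "d \<in> {..<Suc n} \<rightarrow> carrier L"
    using assms(1) by (auto simp: d_def less_Suc_eq Pi_iff)
  \<comment> \<open>Polynomials are coefficient lists with the leading coefficient first, hence the
    reversal; \<open>d\<close> holds the coefficients of X^n - sum c_i X^i.\<close>
  define p where "p = map d (rev [0..<Suc n])"
  have p: "p \<in> carrier (poly_ring L)" "length p = Suc n"
    using d(3) unfolding p_def by (auto simp: sym[OF univ_poly_carrier] polynomial_def d(2))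
  have "size (roots p) = n"
    using roots_over_carrier[OF p(1)] p(2) unfolding splitted_def by simp
  then obtain r where "r \<in># roots p"
    using assms(2) by (metis size_eq_0_iff_empty multiset_nonemptyE less_irrefl)
  then have r: "r \<in> carrier L" "eval p r = \<zero>"
    using roots_mem_iff_is_root[OF p(1)] unfolding is_root_def by auto
  let ?s = "\<Oplus>i\<in>{..<n}. c i \<otimes> r [^] i"
  have s: "?s \<in> carrier L" using assms(1) r(1) by (intro finsum_closed) auto
  have "eval p r = (\<Oplus>i\<in>{..<Suc n}. d i \<otimes> r [^] i)"
    unfolding p_def by (rule eval_rev_upt[OF d(3) r(1)])
  also have "\<dots> = d n \<otimes> r [^] n \<oplus> (\<Oplus>i\<in>{..<n}. d i \<otimes> r [^] i)"
    unfolding lessThan_Suc using d r(1) by (intro finsum_insert) auto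
  also have "(\<Oplus>i\<in>{..<n}. d i \<otimes> r [^] i) = (\<Oplus>i\<in>{..<n}. (\<ominus> \<one>) \<otimes> (c i \<otimes> r [^] i))"
    using assms(1) r(1) by (intro finsum_cong') (auto simp: d_def l_minus Pi_iff)
  also have "\<dots> = (\<ominus> \<one>) \<otimes> ?s"
    using assms(1) r(1) by (intro finsum_rdistr[symmetric]) auto
  finally have "r [^] n \<oplus> \<ominus> ?s = \<zero>"
    using r s d(2) by (simp add: l_minus)
  then have "r [^] n = ?s"
    using minus_equality[of "r [^] n" "\<ominus> ?s"] r(1) s by simp
  then show thesis using that r(1) by blast
qed

lemma (in abelian_group) add_minus_interchange:
  assumes "a \<in> carrier G" "b \<in> carrier G" "c \<in> carrier G" "d \<in> carrier G"
  shows "(a \<oplus> b) \<oplus> \<ominus> (c \<oplus> d) = (a \<oplus> \<ominus> c) \<oplus> (b \<oplus> \<ominus> d)"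
  using assms by (simp add: minus_add a_ac)

context vectorspace
begin

text \<open>Vectors are added one at a time, each outside the span of its predecessors. Independence
  of the image set does not exclude repetitions, so injectivity is carried along for counting and
  reindexing.\<close>

lemma lin_indpt_sequence:
  fixes v :: "nat \<Rightarrow> 'c"
  assumes "\<And>i. v i \<in> carrier V" "\<And>m. m < n \<Longrightarrow> v m \<notin> span (v ` {..<m})"
  shows "lin_indpt (v ` {..<n}) \<and> inj_on v {..<n}"
  using assms(2)
proof (induction n)
  case 0
  show ?case by (auto simp: lin_dep_def)
next
  case (Suc n)
  have IH: "lin_indpt (v ` {..<n})" "inj_on v {..<n}" using Suc by auto
  have sub: "v ` {..<n} \<subseteq> carrier V" using assms(1) by auto
  have notin: "v n \<notin> span (v ` {..<n})" using Suc.prems by simp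
  then have "v n \<notin> v ` {..<n}" using in_own_span[OF sub] by auto
  then show ?case
    using lin_dep_iff_in_span[OF sub IH(1) assms(1)] notin IH(2)
    by (auto simp: lessThan_Suc)
qed

text \<open>In \<open>lincomb\<close> the coefficients are attached to vectors; injectivity of
  \<open>v\<close> lets them be attached to indices instead, as needed to read them as coefficients
  of a polynomial.\<close>

lemma span_sequence:
  fixes v :: "nat \<Rightarrow> 'c"
  assumes "\<And>i. v i \<in> carrier V" "inj_on v {..<n}" "w \<in> span (v ` {..<n})"
  obtains c where "c \<in> {..<n} \<rightarrow> carrier K" "w = (\<Oplus>\<^bsub>V\<^esub>i\<in>{..<n}. c i \<odot>\<^bsub>V\<^esub> v i)"
proof -
  obtain a where a: "a \<in> v ` {..<n} \<rightarrow> carrier K" "lincomb a (v ` {..<n}) = w"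
    using finite_in_span[OF _ _ assms(3)] assms(1) by auto
  have "w = (\<Oplus>\<^bsub>V\<^esub>i\<in>{..<n}. a (v i) \<odot>\<^bsub>V\<^esub> v i)"
    using a assms(1) unfolding lincomb_def
    by (subst M.add.finprod_reindex[OF _ assms(2), symmetric]) (auto simp: Pi_iff)
  then show thesis using a(1) by (intro that[of "a \<circ> v"]) (auto simp: Pi_iff)
qed

text \<open>Let n be least such that T^n x is a combination sum c_i T^i x of lower iterates, let p =
  X^n - sum c_i X^i, and let r be a root of p. With q = p / (X - r), the vector y = q(T) x satisfies
  (T - r) y = p(T) x = 0, and y is not 0 because q is monic of degree n - 1 < n. All iterates of x
  stay in \<open>W\<close>, while dimensions are counted in the ambient space.\<close>

theorem invariant_subspace_eigenvector:
  assumes "algebraically_closed K" "fin_dim"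
    and T: "T \<in> module_hom K V V"
    and W: "VectorSpace.subspace K W V" "T ` W \<subseteq> W" "x \<in> W" "x \<noteq> \<zero>\<^bsub>V\<^esub>"
  obtains r y where "r \<in> carrier K" "y \<in> W" "y \<noteq> \<zero>\<^bsub>V\<^esub>" "T y = r \<odot>\<^bsub>V\<^esub> y"
proof -
  interpret L: algebraically_closed K by fact
  interpret W: LinearCombinations.submodule K W V using W(1) by (simp add: subspace_def)
  interpret T: mod_hom K V V T by unfold_locales (rule T)
  define v where "v i = (T ^^ i) x" for i
  have vW: "v i \<in> W" for i
    by (induction i) (use W in \<open>auto simp: v_def\<close>)
  have v: "v i \<in> carrier V" for i using vW W.subset by auto
  have Tv: "T (v i) = v (Suc i)" for i by (simp add: v_def)
  define sp where "sp n = span (v ` {..<n})" for n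
  have sub: "v ` A \<subseteq> carrier V" for A using v by auto
  \<comment> \<open>Otherwise the first \<open>dim + 1\<close> iterates would be
    independent.\<close>
  have "\<exists>n. v n \<in> sp n"
  proof (rule ccontr)
    assume "\<nexists>n. v n \<in> sp n"
    then have "lin_indpt (v ` {..<Suc dim}) \<and> inj_on v {..<Suc dim}"
      using lin_indpt_sequence[where v = v, OF v] unfolding sp_def by blast
    then show False
      using li_le_dim(2)[OF assms(2) sub[of "{..<Suc dim}"]] by (simp add: card_image)
  qed
  then obtain n where n: "v n \<in> sp n" "\<And>m. m < n \<Longrightarrow> v m \<notin> sp m"
    using LeastI_ex[of "\<lambda>n. v n \<in> sp n"] not_less_Least[of _ "\<lambda>n. v n \<in> sp n"] by blast
  have "n \<noteq> 0"
  proof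
    assume "n = 0"
    then have "x \<in> span {}" using n(1) by (simp add: sp_def v_def)
    then show False using W(4) by (auto simp: span_def lincomb_def)
  qed
  then obtain k where k: "n = Suc k" by (cases n) auto
  have "inj_on v {..<n}"
    using lin_indpt_sequence[where v = v, OF v] n(2) unfolding sp_def by blast
  then obtain c where c: "c \<in> {..<n} \<rightarrow> carrier K"
    and vn: "v n = (\<Oplus>\<^bsub>V\<^esub>i\<in>{..<n}. c i \<odot>\<^bsub>V\<^esub> v i)"
    using span_sequence[where v = v, OF v] n(1) unfolding sp_def by metis
  obtain r where r: "r \<in> carrier K" and rn: "r [^]\<^bsub>K\<^esub> n = (\<Oplus>\<^bsub>K\<^esub>i\<in>{..<n}. c i \<otimes>\<^bsub>K\<^esub> r [^]\<^bsub>K\<^esub> i)"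
    using L.monic_root_exists[OF c] \<open>n \<noteq> 0\<close> by auto
  define D where "D y = T y \<ominus>\<^bsub>V\<^esub> r \<odot>\<^bsub>V\<^esub> y" for y
  have [simp]: "D y \<in> carrier V" if "y \<in> carrier V" for y using that r by (simp add: D_def)
  have D_add: "D (y \<oplus>\<^bsub>V\<^esub> z) = D y \<oplus>\<^bsub>V\<^esub> D z" if "y \<in> carrier V" "z \<in> carrier V" for y z
  proof -
    have "T y \<in> carrier V" "T z \<in> carrier V" "r \<odot>\<^bsub>V\<^esub> y \<in> carrier V" "r \<odot>\<^bsub>V\<^esub> z \<in> carrier V"
      using that r by auto
    then show ?thesis
      using that r by (simp add: D_def M.minus_eq smult_r_distr M.add_minus_interchange)
  qed
  have D_smult: "D (a \<odot>\<^bsub>V\<^esub> y) = a \<odot>\<^bsub>V\<^esub> D y" if "y \<in> carrier V" "a \<in> carrier K" for a y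
    using that r
    by (simp add: D_def smult_r_distr M.minus_eq smult_r_minus smult_assoc1[symmetric] R.m_comm)
  \<comment> \<open>\<open>w i\<close> is \<open>((X ^ i - r ^ i) / (X - r)) x\<close>, where \<open>X\<close> acts as \<open>T\<close>.\<close>
  define w where "w = rec_nat \<zero>\<^bsub>V\<^esub> (\<lambda>i z. v i \<oplus>\<^bsub>V\<^esub> r \<odot>\<^bsub>V\<^esub> z)"
  have w0: "w 0 = \<zero>\<^bsub>V\<^esub>" and wS: "w (Suc i) = v i \<oplus>\<^bsub>V\<^esub> r \<odot>\<^bsub>V\<^esub> w i" for i
    by (simp_all add: w_def)
  have wW: "w i \<in> W" for i
    by (induction i) (use vW r in \<open>auto simp: w0 wS\<close>)
  have w: "w i \<in> carrier V" for i using wW W.subset by auto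
  \<comment> \<open>Multiplying the quotient by X - r gives back X^i - r^i; \<open>D\<close> is T -
    r.\<close>
  have Dw: "D (w i) = v i \<ominus>\<^bsub>V\<^esub> r [^]\<^bsub>K\<^esub> i \<odot>\<^bsub>V\<^esub> x" for i
  proof (induction i)
    case 0
    then show ?case using v[of 0] r by (simp add: w0 D_def v_def smult_r_null M.minus_eq M.r_neg)
  next
    case (Suc i)
    have "D (w (Suc i)) = D (v i) \<oplus>\<^bsub>V\<^esub> r \<odot>\<^bsub>V\<^esub> (v i \<ominus>\<^bsub>V\<^esub> r [^]\<^bsub>K\<^esub> i \<odot>\<^bsub>V\<^esub> x)"
      using Suc v w r by (simp add: wS D_add D_smult)
    also have "\<dots> = (v (Suc i) \<oplus>\<^bsub>V\<^esub> \<ominus>\<^bsub>V\<^esub> (r \<odot>\<^bsub>V\<^esub> v i)) \<oplus>\<^bsub>V\<^esub> (r \<odot>\<^bsub>V\<^esub> v i \<oplus>\<^bsub>V\<^esub> \<ominus>\<^bsub>V\<^esub> (r [^]\<^bsub>K\<^esub> Suc i \<odot>\<^bsub>V\<^esub> x))"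
      using v[of i] v[of "Suc i"] v[of 0] r
      by (simp add: D_def Tv M.minus_eq smult_r_distr smult_r_minus smult_assoc1[symmetric] R.m_comm v_def)
    also have "\<dots> = v (Suc i) \<ominus>\<^bsub>V\<^esub> r [^]\<^bsub>K\<^esub> Suc i \<odot>\<^bsub>V\<^esub> x"
    proof -
      have "v (Suc i) \<in> carrier V" "r \<odot>\<^bsub>V\<^esub> v i \<in> carrier V" "r [^]\<^bsub>K\<^esub> Suc i \<odot>\<^bsub>V\<^esub> x \<in> carrier V"
        using v v[of 0] r by (auto simp: v_def)
      then show ?thesis by (simp add: M.minus_eq M.a_assoc M.r_neg1)
    qed
    finally show ?case .
  qed
  \<comment> \<open>As a polynomial in T, \<open>w i\<close> has degree less than i, so it involves
    only the first i iterates.\<close>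
  have wsp: "w i \<in> sp m" if "i \<le> m" for i m using that
  proof (induction i)
    case 0
    interpret S: LinearCombinations.submodule K "sp m" V
      unfolding sp_def using span_is_submodule[OF sub] .
    show ?case by (simp add: w0)
  next
    case (Suc i)
    interpret S: LinearCombinations.submodule K "sp m" V
      unfolding sp_def using span_is_submodule[OF sub] .
    have "v i \<in> sp m" using in_own_span[OF sub[of "{..<m}"]] Suc.prems unfolding sp_def by auto
    then show ?case using Suc r by (simp add: wS)
  qed
  \<comment> \<open>The termwise quotient of sum c_i X^i, minus its value at r, by X - r, applied to
    x. Partial sums are used so that \<open>Ds\<close> can be proved by induction.\<close>
  define s where "s j = (\<Oplus>\<^bsub>V\<^esub>i\<in>{..<j}. c i \<odot>\<^bsub>V\<^esub> w i)" for j
  have sS: "s (Suc j) = c j \<odot>\<^bsub>V\<^esub> w j \<oplus>\<^bsub>V\<^esub> s j" if "j < n" for j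
    unfolding s_def lessThan_Suc using c w that by (intro M.finsum_insert) (auto simp: Pi_iff)
  have s: "s j \<in> carrier V" if "j \<le> n" for j
    unfolding s_def using c w that by (intro M.finsum_closed) (auto simp: Pi_iff)
  \<comment> \<open>The submodule is left arbitrary: \<open>W\<close> will place the eigenvector,
    and the span of the first n - 1 iterates will show that it is nonzero.\<close>
  have ssp: "s j \<in> U" if U: "LinearCombinations.submodule K U V" "\<And>i. i < j \<Longrightarrow> w i \<in> U" and "j \<le> n" for j U
    using that(2,3)
  proof (induction j)
    case 0
    then show ?case using submodule.zero_closed[OF U(1)] by (simp add: s_def)
  next
    case (Suc j)
    interpret S: LinearCombinations.submodule K U V by fact
    show ?case using Suc c by (auto simp: sS Pi_iff)
  qed
  have Ds: "D (s j) = (\<Oplus>\<^bsub>V\<^esub>i\<in>{..<j}. c i \<odot>\<^bsub>V\<^esub> v i) \<ominus>\<^bsub>V\<^esub> (\<Oplus>\<^bsub>K\<^esub>i\<in>{..<j}. c i \<otimes>\<^bsub>K\<^esub> r [^]\<^bsub>K\<^esub> i) \<odot>\<^bsub>V\<^esub> x"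
    if "j \<le> n" for j using that
  proof (induction j)
    case 0
    then show ?case using v[of 0] r by (simp add: s_def D_def v_def smult_r_null smult_l_null M.minus_eq M.r_neg)
  next
    case (Suc j)
    let ?A = "\<Oplus>\<^bsub>V\<^esub>i\<in>{..<j}. c i \<odot>\<^bsub>V\<^esub> v i" and ?B = "\<Oplus>\<^bsub>K\<^esub>i\<in>{..<j}. c i \<otimes>\<^bsub>K\<^esub> r [^]\<^bsub>K\<^esub> i"
    have cj: "c j \<in> carrier K" "c \<in> {..<j} \<rightarrow> carrier K" using c Suc.prems by auto
    have x: "x \<in> carrier V" using v[of 0] by (simp add: v_def)
    have AB: "?A \<in> carrier V" "?B \<in> carrier K"
      using cj v r by (auto intro!: M.finsum_closed R.finsum_closed)
    have A': "(\<Oplus>\<^bsub>V\<^esub>i\<in>{..<Suc j}. c i \<odot>\<^bsub>V\<^esub> v i) = c j \<odot>\<^bsub>V\<^esub> v j \<oplus>\<^bsub>V\<^esub> ?A"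
      unfolding lessThan_Suc using cj v by (intro M.finsum_insert) (auto simp: Pi_iff)
    have B': "(\<Oplus>\<^bsub>K\<^esub>i\<in>{..<Suc j}. c i \<otimes>\<^bsub>K\<^esub> r [^]\<^bsub>K\<^esub> i) = c j \<otimes>\<^bsub>K\<^esub> r [^]\<^bsub>K\<^esub> j \<oplus>\<^bsub>K\<^esub> ?B"
      unfolding lessThan_Suc using cj r by (intro R.finsum_insert) (auto simp: Pi_iff)
    have "D (s (Suc j)) = c j \<odot>\<^bsub>V\<^esub> (v j \<ominus>\<^bsub>V\<^esub> r [^]\<^bsub>K\<^esub> j \<odot>\<^bsub>V\<^esub> x) \<oplus>\<^bsub>V\<^esub> (?A \<ominus>\<^bsub>V\<^esub> ?B \<odot>\<^bsub>V\<^esub> x)"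
      using Suc s[of j] w cj Dw by (simp add: sS D_add D_smult)
    also have "\<dots> = (c j \<odot>\<^bsub>V\<^esub> v j \<oplus>\<^bsub>V\<^esub> ?A) \<ominus>\<^bsub>V\<^esub> (c j \<otimes>\<^bsub>K\<^esub> r [^]\<^bsub>K\<^esub> j \<oplus>\<^bsub>K\<^esub> ?B) \<odot>\<^bsub>V\<^esub> x"
      using AB cj v[of j] x r
      by (simp add: M.minus_eq M.add_minus_interchange smult_r_distr smult_l_distr smult_r_minus smult_assoc1)
    finally show ?case by (simp add: A' B')
  qed
  \<comment> \<open>This is (p(X) - p(r)) / (X - r) applied to x, and p(r) = 0 by the choice of
    r.\<close>
  define y where "y = w n \<ominus>\<^bsub>V\<^esub> s n"
  have sW: "s n \<in> W" using ssp[OF W.submodule_axioms] wW by blast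
  have y: "y \<in> carrier V" using w s by (simp add: y_def)
  have yW: "y \<in> W"
    using wW[of n] W.smult_closed[OF _ sW, of "\<ominus>\<^bsub>K\<^esub> \<one>\<^bsub>K\<^esub>"] s[of n]
    by (simp add: y_def M.minus_eq smult_l_minus)
  have eq: "w n = y \<oplus>\<^bsub>V\<^esub> s n" using w[of n] s[of n]
    by (simp add: y_def M.minus_eq M.a_assoc M.l_neg)
  have "D (w n) = D (s n)" using Dw[of n] Ds[of n] by (simp add: vn rn)
  then have "D y = \<zero>\<^bsub>V\<^esub>"
    using D_add[of y "s n"] y s[of n] eq by simp
  then have Ty: "T y = r \<odot>\<^bsub>V\<^esub> y"
    unfolding D_def using y r by simp
  \<comment> \<open>With n = k + 1, the top term of \<open>w n\<close> is \<open>v k\<close>, while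
    \<open>s n\<close> and \<open>r\<close> times \<open>w k\<close> lie in \<open>sp k\<close>. If
    y vanished, \<open>v k\<close> would lie in \<open>sp k\<close>, against the minimality of
    n.\<close>
  have "y \<noteq> \<zero>\<^bsub>V\<^esub>"
  proof
    assume "y = \<zero>\<^bsub>V\<^esub>"
    interpret S: LinearCombinations.submodule K "sp k" V
      unfolding sp_def using span_is_submodule[OF sub] .
    have sk: "s n \<in> sp k" by (rule ssp[OF S.submodule_axioms]) (auto simp: k intro!: wsp)
    have wk: "(\<ominus>\<^bsub>K\<^esub> r) \<odot>\<^bsub>V\<^esub> w k \<in> sp k" using wsp[of k k] r by simp
    have "s n = v k \<oplus>\<^bsub>V\<^esub> r \<odot>\<^bsub>V\<^esub> w k"
      using eq \<open>y = \<zero>\<^bsub>V\<^esub>\<close> s[of n] by (simp add: k wS)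
    then have "v k = s n \<oplus>\<^bsub>V\<^esub> (\<ominus>\<^bsub>K\<^esub> r) \<odot>\<^bsub>V\<^esub> w k"
      using v[of k] w[of k] r by (simp add: smult_l_minus M.a_assoc M.r_neg)
    also have "\<dots> \<in> sp k" using sk wk by simp
    finally show False using n(2)[of k] k by simp
  qed
  then show thesis using that r yW Ty by blast
qed

end

section \<open>Left modules and relative injectivity\<close>

context left_module
begin

lemma smult_r_zero: "r \<in> carrier R \<Longrightarrow> r \<odot>\<^bsub>M\<^esub> \<zero>\<^bsub>M\<^esub> = \<zero>\<^bsub>M\<^esub>"
  using smult_r_distr[of r "\<zero>\<^bsub>M\<^esub>" "\<zero>\<^bsub>M\<^esub>"] smult_closed[of r "\<zero>\<^bsub>M\<^esub>"] by simp

lemma smult_l_zero: "x \<in> carrier M \<Longrightarrow> \<zero> \<odot>\<^bsub>M\<^esub> x = \<zero>\<^bsub>M\<^esub>"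
  using smult_l_distr[of \<zero> \<zero> x] smult_closed[of \<zero> x] by simp

lemma smult_r_minus: "r \<in> carrier R \<Longrightarrow> x \<in> carrier M \<Longrightarrow> r \<odot>\<^bsub>M\<^esub> (\<ominus>\<^bsub>M\<^esub> x) = \<ominus>\<^bsub>M\<^esub> (r \<odot>\<^bsub>M\<^esub> x)"
  using smult_r_distr[of r "\<ominus>\<^bsub>M\<^esub> x" x] smult_closed[of r "\<ominus>\<^bsub>M\<^esub> x"] smult_closed[of r x]
  by (simp add: M.l_neg smult_r_zero M.minus_equality)

lemma smult_minus_one: "x \<in> carrier M \<Longrightarrow> (\<ominus> \<one>) \<odot>\<^bsub>M\<^esub> x = \<ominus>\<^bsub>M\<^esub> x"
  using smult_l_distr[of "\<ominus> \<one>" \<one> x] smult_closed[of "\<ominus> \<one>" x]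
  by (simp add: R.l_neg smult_l_zero smult_one M.minus_equality)

text \<open>Negatives come for free, as multiples by the scalar -1.\<close>

lemma submoduleI:
  assumes "N \<subseteq> carrier M" "\<zero>\<^bsub>M\<^esub> \<in> N" "\<And>x y. x \<in> N \<Longrightarrow> y \<in> N \<Longrightarrow> x \<oplus>\<^bsub>M\<^esub> y \<in> N"
    and smult: "\<And>r x. r \<in> carrier R \<Longrightarrow> x \<in> N \<Longrightarrow> r \<odot>\<^bsub>M\<^esub> x \<in> N"
  shows "Module.submodule N R M"
proof -
  have "\<ominus>\<^bsub>M\<^esub> x \<in> N" if "x \<in> N" for x
    using smult[of "\<ominus> \<one>" x] assms(1) that by (auto simp: smult_minus_one)
  then show ?thesis
    using assms by unfold_locales (auto simp: a_inv_def)
qed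

lemma submoduleD:
  assumes "Module.submodule N R M"
  shows "N \<subseteq> carrier M" "\<zero>\<^bsub>M\<^esub> \<in> N" "\<And>x y. x \<in> N \<Longrightarrow> y \<in> N \<Longrightarrow> x \<oplus>\<^bsub>M\<^esub> y \<in> N"
    "\<And>r x. r \<in> carrier R \<Longrightarrow> x \<in> N \<Longrightarrow> r \<odot>\<^bsub>M\<^esub> x \<in> N" "\<And>x. x \<in> N \<Longrightarrow> \<ominus>\<^bsub>M\<^esub> x \<in> N"
proof -
  interpret N: Module.submodule N R M by fact
  show "N \<subseteq> carrier M" "\<zero>\<^bsub>M\<^esub> \<in> N" "\<And>x y. x \<in> N \<Longrightarrow> y \<in> N \<Longrightarrow> x \<oplus>\<^bsub>M\<^esub> y \<in> N"
    "\<And>r x. r \<in> carrier R \<Longrightarrow> x \<in> N \<Longrightarrow> r \<odot>\<^bsub>M\<^esub> x \<in> N" "\<And>x. x \<in> N \<Longrightarrow> \<ominus>\<^bsub>M\<^esub> x \<in> N"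
    using N.subset N.one_closed N.m_closed N.smult_closed N.m_inv_closed by (auto simp: a_inv_def)
qed

lemma left_module_submodule:
  assumes "Module.submodule N R M"
  shows "left_module R (M\<lparr>carrier := N\<rparr>)"
proof -
  note N = submoduleD[OF assms]
  have "abelian_group (M\<lparr>carrier := N\<rparr>)"
  proof (rule abelian_groupI)
    show "\<exists>y\<in>carrier (M\<lparr>carrier := N\<rparr>). y \<oplus>\<^bsub>M\<lparr>carrier := N\<rparr>\<^esub> x = \<zero>\<^bsub>M\<lparr>carrier := N\<rparr>\<^esub>"
      if "x \<in> carrier (M\<lparr>carrier := N\<rparr>)" for x
      using that N(1,5) by (auto intro!: bexI[of _ "\<ominus>\<^bsub>M\<^esub> x"] simp: M.l_neg subset_iff)
  qed (use N in \<open>auto simp: subset_iff M.a_ac\<close>)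
  then show ?thesis
    using N R.ring_axioms smult_l_distr smult_r_distr smult_assoc1 smult_one
    by (auto simp: left_module_def left_module_axioms_def subset_iff)
qed

end

section \<open>Homomorphisms, their images and preimages, and simple modules\<close>

lemma module_hom_in_carrier: "f \<in> module_hom R M N \<Longrightarrow> x \<in> carrier M \<Longrightarrow> f x \<in> carrier N"
  using module_hom_closed by blast

lemma module_hom_zero:
  assumes "left_module R M" "left_module R N" "f \<in> module_hom R M N"
  shows "f \<zero>\<^bsub>M\<^esub> = \<zero>\<^bsub>N\<^esub>"
proof -
  interpret M: left_module R M by fact
  interpret N: left_module R N by fact
  show ?thesis
    using module_hom_in_carrier[OF assms(3)] module_hom_smult[OF assms(3), of "\<zero>\<^bsub>R\<^esub>" "\<zero>\<^bsub>M\<^esub>"]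
    by (simp add: M.smult_l_zero N.smult_l_zero)
qed

lemma module_hom_minus:
  assumes "left_module R M" "left_module R N" "f \<in> module_hom R M N" "x \<in> carrier M"
  shows "f (\<ominus>\<^bsub>M\<^esub> x) = \<ominus>\<^bsub>N\<^esub> f x"
proof -
  interpret M: left_module R M by fact
  interpret N: left_module R N by fact
  show ?thesis
    using module_hom_in_carrier[OF assms(3)] module_hom_smult[OF assms(3), of "\<ominus>\<^bsub>R\<^esub> \<one>\<^bsub>R\<^esub>" x] assms(4)
    by (simp add: M.smult_minus_one N.smult_minus_one)
qed

lemma submodule_image:
  assumes "left_module R M" "left_module R N" "f \<in> module_hom R M N"
  shows "Module.submodule (f ` carrier M) R N"
proof -
  interpret M: left_module R M by fact
  interpret N: left_module R N by fact
  show ?thesis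
  proof (rule N.submoduleI)
    show "\<zero>\<^bsub>N\<^esub> \<in> f ` carrier M"
      using module_hom_zero[OF assms] by (metis M.zero_closed imageI)
  qed (use module_hom_in_carrier[OF assms(3)] in
      \<open>auto simp: module_hom_add[OF assms(3), symmetric] module_hom_smult[OF assms(3), symmetric] M.smult_closed\<close>)
qed

lemma submodule_vimage:
  assumes "left_module R M" "left_module R N" "f \<in> module_hom R M N" "Module.submodule U R N"
  shows "Module.submodule {x \<in> carrier M. f x \<in> U} R M"
proof -
  interpret M: left_module R M by fact
  interpret N: left_module R N by fact
  show ?thesis
    by (rule M.submoduleI)
      (use N.submoduleD[OF assms(4)] in
        \<open>auto simp: module_hom_zero[OF assms(1-3)] module_hom_add[OF assms(3)] module_hom_smult[OF assms(3)] M.smult_closed\<close>)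
qed

lemma module_hom_inj_on:
  assumes "left_module R M" "left_module R N" "f \<in> module_hom R M N"
    and "\<And>x. x \<in> carrier M \<Longrightarrow> f x = \<zero>\<^bsub>N\<^esub> \<Longrightarrow> x = \<zero>\<^bsub>M\<^esub>"
  shows "inj_on f (carrier M)"
proof (rule inj_onI)
  interpret M: left_module R M by fact
  interpret N: left_module R N by fact
  fix x y assume xy: "x \<in> carrier M" "y \<in> carrier M" "f x = f y"
  then have "f y \<in> carrier N" using module_hom_in_carrier[OF assms(3)] by auto
  then have "f (x \<ominus>\<^bsub>M\<^esub> y) = \<zero>\<^bsub>N\<^esub>"
    using xy by (simp add: M.minus_eq module_hom_add[OF assms(3)] module_hom_minus[OF assms(1-3)] N.M.r_neg)
  then have "x \<ominus>\<^bsub>M\<^esub> y = \<zero>\<^bsub>M\<^esub>" using assms(4) xy by simp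
  then show "x = y" using xy by simp
qed

text \<open>One half of Schur's lemma: the kernel is a submodule that misses z, so simplicity of the
  source makes it zero.\<close>

lemma simple_module_hom_inj_on:
  assumes "simple_module R P" "left_module R N" "f \<in> module_hom R P N"
    and "z \<in> carrier P" "f z \<noteq> \<zero>\<^bsub>N\<^esub>"
  shows "inj_on f (carrier P)"
proof -
  interpret P: left_module R P using assms(1) by (simp add: simple_module_def)
  interpret N: left_module R N by fact
  have "Module.submodule {\<zero>\<^bsub>N\<^esub>} R N"
    by (rule N.submoduleI) (auto simp: N.smult_r_zero)
  then have "Module.submodule {x \<in> carrier P. f x \<in> {\<zero>\<^bsub>N\<^esub>}} R P"
    by (rule submodule_vimage[OF P.left_module_axioms assms(2,3)])
  then have "{x \<in> carrier P. f x \<in> {\<zero>\<^bsub>N\<^esub>}} = {\<zero>\<^bsub>P\<^esub>}"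
    using assms(1,4,5) unfolding simple_module_def by blast
  then show ?thesis
    by (intro module_hom_inj_on[OF P.left_module_axioms assms(2,3)]) auto
qed

text \<open>\<open>\<Gamma>\<close> is the graph of a homomorphism that is defined on a submodule of \<open>N\<close>.\<close>

lemma relatively_injective_extend_graph:
  assumes "left_module R M" "left_module R N" "relatively_injective R M N"
    and \<Gamma>: "\<Gamma> \<subseteq> carrier N \<times> carrier M" "(\<zero>\<^bsub>N\<^esub>, \<zero>\<^bsub>M\<^esub>) \<in> \<Gamma>"
      "\<And>x y x' y'. (x, y) \<in> \<Gamma> \<Longrightarrow> (x', y') \<in> \<Gamma> \<Longrightarrow> (x \<oplus>\<^bsub>N\<^esub> x', y \<oplus>\<^bsub>M\<^esub> y') \<in> \<Gamma>"
      "\<And>r x y. r \<in> carrier R \<Longrightarrow> (x, y) \<in> \<Gamma> \<Longrightarrow> (r \<odot>\<^bsub>N\<^esub> x, r \<odot>\<^bsub>M\<^esub> y) \<in> \<Gamma>"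
      "\<And>y. (\<zero>\<^bsub>N\<^esub>, y) \<in> \<Gamma> \<Longrightarrow> y = \<zero>\<^bsub>M\<^esub>"
  obtains h where "h \<in> module_hom R N M" "\<And>x y. (x, y) \<in> \<Gamma> \<Longrightarrow> h x = y"
proof -
  interpret M: left_module R M by fact
  interpret N: left_module R N by fact
  \<comment> \<open>Two values over the same point differ by a value over 0, so the condition at 0
    makes the whole relation single-valued.\<close>
  have sv: "y = y'" if "(x, y) \<in> \<Gamma>" "(x, y') \<in> \<Gamma>" for x y y'
  proof -
    have c: "x \<in> carrier N" "y \<in> carrier M" "y' \<in> carrier M" using that \<Gamma>(1) by auto
    have "(x \<oplus>\<^bsub>N\<^esub> (\<ominus>\<^bsub>R\<^esub> \<one>\<^bsub>R\<^esub>) \<odot>\<^bsub>N\<^esub> x, y \<oplus>\<^bsub>M\<^esub> (\<ominus>\<^bsub>R\<^esub> \<one>\<^bsub>R\<^esub>) \<odot>\<^bsub>M\<^esub> y') \<in> \<Gamma>"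
      using that by (intro \<Gamma>(3,4)) auto
    then have "(\<zero>\<^bsub>N\<^esub>, y \<ominus>\<^bsub>M\<^esub> y') \<in> \<Gamma>"
      using c by (simp add: M.smult_minus_one N.smult_minus_one N.M.r_neg M.M.minus_eq)
    then have "y \<ominus>\<^bsub>M\<^esub> y' = \<zero>\<^bsub>M\<^esub>" by (rule \<Gamma>(5))
    then show ?thesis using c by simp
  qed
  define D where "D = fst ` \<Gamma>"
  have D: "Module.submodule D R N"
  proof (rule N.submoduleI)
    show "D \<subseteq> carrier N" "\<zero>\<^bsub>N\<^esub> \<in> D"
      using \<Gamma>(1) by (auto simp: D_def intro!: image_eqI[OF _ \<Gamma>(2)])
    show "x \<oplus>\<^bsub>N\<^esub> x' \<in> D" if "x \<in> D" "x' \<in> D" for x x'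
      using that by (auto simp: D_def intro!: image_eqI[OF _ \<Gamma>(3)])
    show "r \<odot>\<^bsub>N\<^esub> x \<in> D" if "r \<in> carrier R" "x \<in> D" for r x
      using that by (auto simp: D_def intro!: image_eqI[OF _ \<Gamma>(4)])
  qed
  define k where "k x = (THE y. (x, y) \<in> \<Gamma>)" for x
  have k: "k x = y" if "(x, y) \<in> \<Gamma>" for x y
    unfolding k_def using that sv by blast
  have k\<Gamma>: "(x, k x) \<in> \<Gamma>" if "x \<in> D" for x
    using that k by (auto simp: D_def)
  have "k \<in> module_hom R (N\<lparr>carrier := D\<rparr>) M"
    using \<Gamma>(1) k\<Gamma> by (auto simp: module_hom_def intro!: k \<Gamma>(3,4))
  \<comment> \<open>The embedding to which relative injectivity is applied is the inclusion of the
    domain of the graph.\<close>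
  moreover have "(\<lambda>x. x) \<in> module_hom R (N\<lparr>carrier := D\<rparr>) N"
    using N.submoduleD(1)[OF D] by (auto simp: module_hom_def)
  ultimately obtain h where "h \<in> module_hom R N M" "\<forall>x\<in>D. h x = k x"
    using assms(3)[unfolded relatively_injective_def, rule_format,
        OF N.left_module_submodule[OF D], of "\<lambda>x. x" k] by auto
  then show thesis using that k by (force simp: D_def)
qed

text \<open>Elements of \<open>End_ring\<close> are extensional, whereas the maps supplied by
  relative injectivity are arbitrary off the carrier. Passing to their restrictions does not affect
  values on the carrier.\<close>

lemma End_ring_commute:
  assumes comm: "\<forall>f \<in> carrier (End_ring R M). \<forall>g \<in> carrier (End_ring R M).
      f \<otimes>\<^bsub>End_ring R M\<^esub> g = g \<otimes>\<^bsub>End_ring R M\<^esub> f"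
    and "left_module R M" "f \<in> module_hom R M M" "g \<in> module_hom R M M" "x \<in> carrier M"
  shows "f (g x) = g (f x)"
proof -
  interpret left_module R M by fact
  have "restrict h (carrier M) \<in> carrier (End_ring R M)" if "h \<in> module_hom R M M" for h
    using that by (auto simp: End_ring_def module_hom_def smult_closed)
  then have "compose (carrier M) (restrict f (carrier M)) (restrict g (carrier M)) x =
      compose (carrier M) (restrict g (carrier M)) (restrict f (carrier M)) x"
    using comm assms(3,4) by (auto simp: End_ring_def)
  then show ?thesis
    using assms(5) module_hom_in_carrier[OF assms(3)] module_hom_in_carrier[OF assms(4)]
    by (auto simp: compose_def)
qed

section \<open>Restriction of scalars and algebras over a field\<close>

lemma left_module_restrict_scalars:
  assumes "left_module S M" "ring R" "\<phi> \<in> ring_hom R S"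
  shows "left_module R (restrict_scalars \<phi> M)"
proof -
  interpret left_module S M by fact
  have "abelian_group (restrict_scalars \<phi> M)"
  proof (rule abelian_groupI)
    show "\<exists>y\<in>carrier (restrict_scalars \<phi> M). y \<oplus>\<^bsub>restrict_scalars \<phi> M\<^esub> x = \<zero>\<^bsub>restrict_scalars \<phi> M\<^esub>"
      if "x \<in> carrier (restrict_scalars \<phi> M)" for x
      using that by (auto intro!: bexI[of _ "\<ominus>\<^bsub>M\<^esub> x"] simp: M.l_neg restrict_scalars_def)
  qed (auto simp: restrict_scalars_def M.a_ac)
  then show ?thesis
    using assms(2,3) smult_closed smult_l_distr smult_r_distr smult_assoc1 smult_one
    by (auto simp: left_module_def left_module_axioms_def restrict_scalars_def ring_hom_def Pi_iff)
qed

text \<open>Gives access to the linear algebra of \<open>vectorspace\<close> for the underlying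
  space of a representation.\<close>

lemma module_left_module: "cring R \<Longrightarrow> left_module R M \<Longrightarrow> module R M"
  by (simp add: left_module_def left_module_axioms_def module_def module_axioms_def)

text \<open>An algebra over \<open>F\<close>, given by its structure map into the centre. The
  argument with commuting endomorphisms uses no more about the group ring of \<open>H\<close> than
  this, so it is carried out here without mention of groups.\<close>

locale central_algebra = F?: field F + A: ring A
  for F :: "('f, 'x) ring_scheme" and A :: "('r, 'y) ring_scheme" +
  fixes \<iota> :: "'f \<Rightarrow> 'r"
  assumes hom: "\<iota> \<in> ring_hom F A"
    and central: "\<lbrakk>c \<in> carrier F; a \<in> carrier A\<rbrakk> \<Longrightarrow> \<iota> c \<otimes>\<^bsub>A\<^esub> a = a \<otimes>\<^bsub>A\<^esub> \<iota> c"
begin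

lemma closed: "c \<in> carrier F \<Longrightarrow> \<iota> c \<in> carrier A"
  using ring_hom_closed[OF hom] .

lemma vectorspace_restrict_scalars:
  assumes "left_module A V"
  shows "vectorspace F (restrict_scalars \<iota> V)"
  using module_left_module[OF F.is_cring left_module_restrict_scalars[OF assms F.ring_axioms hom]]
  by (simp add: vectorspace_def F.field_axioms)

text \<open>A nonzero \<open>f\<close> spans the space of homomorphisms from \<open>P\<close> to
  \<open>V\<close>; this is the bound on the multiplicity.\<close>

theorem hom_simple_into_self_injective:
  assumes "algebraically_closed F"
    and V: "left_module A V" "vectorspace.fin_dim F (restrict_scalars \<iota> V)" "relatively_injective A V V"
    and comm: "\<forall>f \<in> carrier (End_ring A V). \<forall>g \<in> carrier (End_ring A V).
      f \<otimes>\<^bsub>End_ring A V\<^esub> g = g \<otimes>\<^bsub>End_ring A V\<^esub> f"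
    and P: "simple_module A P"
    and f: "f \<in> module_hom A P V" "z \<in> carrier P" "f z \<noteq> \<zero>\<^bsub>V\<^esub>"
    and g: "g \<in> module_hom A P V"
  obtains c where "c \<in> carrier F" "\<And>x. x \<in> carrier P \<Longrightarrow> g x = \<iota> c \<odot>\<^bsub>V\<^esub> f x"
proof (cases "\<forall>x\<in>carrier P. g x = \<zero>\<^bsub>V\<^esub>")
  \<comment> \<open>The zero map is the multiple with c = 0. Once it is set aside, \<open>g\<close>
    is injective too, and the contradiction \<open>g z = 0\<close> below relies on that.\<close>
  case True
  interpret V: left_module A V by fact
  have "g x = \<iota> \<zero>\<^bsub>F\<^esub> \<odot>\<^bsub>V\<^esub> f x" if "x \<in> carrier P" for x
    using True that ring_hom_zero[OF hom F.ring_axioms A.ring_axioms] module_hom_in_carrier[OF f(1)]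
    by (auto simp: V.smult_l_zero Pi_iff)
  then show thesis using that by blast
next
  case False
  then obtain z' where z': "z' \<in> carrier P" "g z' \<noteq> \<zero>\<^bsub>V\<^esub>" by blast
  interpret V: left_module A V by fact
  interpret P: left_module A P using P by (simp add: simple_module_def)
  note lm = P.left_module_axioms V.left_module_axioms
  have fc: "f x \<in> carrier V" and gc: "g x \<in> carrier V" if "x \<in> carrier P" for x
    using that module_hom_in_carrier[OF f(1)] module_hom_in_carrier[OF g] by auto
  note hs = module_hom_add[OF f(1)] module_hom_add[OF g] module_hom_smult[OF f(1)] module_hom_smult[OF g]
  note f0 = module_hom_zero[OF lm f(1)] and g0 = module_hom_zero[OF lm g]
  have f_inj: "inj_on f (carrier P)" and g_inj: "inj_on g (carrier P)"
    using simple_module_hom_inj_on[OF P V(1)] f g z' by blast+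
  have f_ker: "x = \<zero>\<^bsub>P\<^esub>" if "x \<in> carrier P" "f x = \<zero>\<^bsub>V\<^esub>" for x
    using inj_onD[OF f_inj, of x "\<zero>\<^bsub>P\<^esub>"] that f0 by simp
  have g_ker: "x = \<zero>\<^bsub>P\<^esub>" if "x \<in> carrier P" "g x = \<zero>\<^bsub>V\<^esub>" for x
    using inj_onD[OF g_inj, of x "\<zero>\<^bsub>P\<^esub>"] that g0 by simp
  have simple: "N = carrier P" if "Module.submodule N A P" "x \<in> N" "x \<noteq> \<zero>\<^bsub>P\<^esub>" for N x
    using P that unfolding simple_module_def by blast
  have z0: "z \<noteq> \<zero>\<^bsub>P\<^esub>" using f(3) f0 by auto
  \<comment> \<open>Graph of \<open>g\<close> after the inverse of \<open>f\<close>; it is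
    single-valued because \<open>f\<close> is injective.\<close>
  define \<Gamma> where "\<Gamma> = (\<lambda>x. (f x, g x)) ` carrier P"
  obtain T where T: "T \<in> module_hom A V V" and "\<And>x y. (x, y) \<in> \<Gamma> \<Longrightarrow> T x = y"
  proof (rule relatively_injective_extend_graph[OF V(1) V(1) V(3), of \<Gamma>])
    show "\<Gamma> \<subseteq> carrier V \<times> carrier V" by (auto simp: \<Gamma>_def fc gc)
    show "(\<zero>\<^bsub>V\<^esub>, \<zero>\<^bsub>V\<^esub>) \<in> \<Gamma>"
      unfolding \<Gamma>_def by (rule image_eqI[of _ _ "\<zero>\<^bsub>P\<^esub>"]) (auto simp: f0 g0)
    show "(x \<oplus>\<^bsub>V\<^esub> x', y \<oplus>\<^bsub>V\<^esub> y') \<in> \<Gamma>" if xy: "(x, y) \<in> \<Gamma>" "(x', y') \<in> \<Gamma>" for x y x' y'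
    proof -
      obtain a b where "a \<in> carrier P" "b \<in> carrier P" "x = f a" "y = g a" "x' = f b" "y' = g b"
        using xy by (auto simp: \<Gamma>_def)
      then show ?thesis unfolding \<Gamma>_def by (intro image_eqI[of _ _ "a \<oplus>\<^bsub>P\<^esub> b"]) (auto simp: hs)
    qed
    show "(r \<odot>\<^bsub>V\<^esub> x, r \<odot>\<^bsub>V\<^esub> y) \<in> \<Gamma>" if r: "r \<in> carrier A" "(x, y) \<in> \<Gamma>" for r x y
    proof -
      obtain a where "a \<in> carrier P" "x = f a" "y = g a"
        using r by (auto simp: \<Gamma>_def)
      then show ?thesis unfolding \<Gamma>_def using r
        by (intro image_eqI[of _ _ "r \<odot>\<^bsub>P\<^esub> a"]) (auto simp: hs P.smult_closed)
    qed
    show "y = \<zero>\<^bsub>V\<^esub>" if y: "(\<zero>\<^bsub>V\<^esub>, y) \<in> \<Gamma>" for y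
    proof -
      obtain a where "a \<in> carrier P" "(\<zero>\<^bsub>V\<^esub>, y) = (f a, g a)"
        using y unfolding \<Gamma>_def by blast
      then show ?thesis using f_ker[of a] g0 by simp
    qed
  qed blast
  then have Tf: "T (f x) = g x" if "x \<in> carrier P" for x using that by (auto simp: \<Gamma>_def)
  let ?S = "f ` carrier P"
  have S: "Module.submodule ?S A V" by (rule submodule_image[OF lm f(1)])
  note SD = V.submoduleD[OF S]
  have gS: "g x \<in> ?S" if "x \<in> carrier P" for x
  proof (rule ccontr)
    assume "g x \<notin> ?S"
    \<comment> \<open>The preimage of f P under g is a submodule that misses x, hence zero: the
      images of f and g meet trivially.\<close>
    then have disj: "b = \<zero>\<^bsub>P\<^esub>" if "b \<in> carrier P" "g b \<in> ?S" for b
      using simple[OF submodule_vimage[OF lm g S], of b] that \<open>x \<in> carrier P\<close> by auto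
    \<comment> \<open>Graph of the projection of f P + g P onto f P along g P. It is single-valued
      since f a + g b = 0 puts g b into f P, so that b = 0 by \<open>disj\<close> and then f a =
      0.\<close>
    define \<Delta> where "\<Delta> = (\<lambda>(a, b). (f a \<oplus>\<^bsub>V\<^esub> g b, f a)) ` (carrier P \<times> carrier P)"
    obtain B where B: "B \<in> module_hom A V V" and "\<And>x y. (x, y) \<in> \<Delta> \<Longrightarrow> B x = y"
    proof (rule relatively_injective_extend_graph[OF V(1) V(1) V(3), of \<Delta>])
      show "\<Delta> \<subseteq> carrier V \<times> carrier V" by (auto simp: \<Delta>_def fc gc)
      show "(\<zero>\<^bsub>V\<^esub>, \<zero>\<^bsub>V\<^esub>) \<in> \<Delta>"
        unfolding \<Delta>_def by (rule image_eqI[of _ _ "(\<zero>\<^bsub>P\<^esub>, \<zero>\<^bsub>P\<^esub>)"]) (auto simp: f0 g0)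
      show "(x \<oplus>\<^bsub>V\<^esub> x', y \<oplus>\<^bsub>V\<^esub> y') \<in> \<Delta>" if xy: "(x, y) \<in> \<Delta>" "(x', y') \<in> \<Delta>" for x y x' y'
      proof -
        obtain a b a' b' where ab: "a \<in> carrier P" "b \<in> carrier P" "a' \<in> carrier P" "b' \<in> carrier P"
          "x = f a \<oplus>\<^bsub>V\<^esub> g b" "y = f a" "x' = f a' \<oplus>\<^bsub>V\<^esub> g b'" "y' = f a'"
          using xy by (auto simp: \<Delta>_def)
        then show ?thesis unfolding \<Delta>_def
          by (intro image_eqI[of _ _ "(a \<oplus>\<^bsub>P\<^esub> a', b \<oplus>\<^bsub>P\<^esub> b')"]) (auto simp: hs fc gc V.M.a_ac)
      qed
      show "(r \<odot>\<^bsub>V\<^esub> x, r \<odot>\<^bsub>V\<^esub> y) \<in> \<Delta>" if r: "r \<in> carrier A" "(x, y) \<in> \<Delta>" for r x y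
      proof -
        obtain a b where ab: "a \<in> carrier P" "b \<in> carrier P" "x = f a \<oplus>\<^bsub>V\<^esub> g b" "y = f a"
          using r by (auto simp: \<Delta>_def)
        then show ?thesis unfolding \<Delta>_def using r
          by (intro image_eqI[of _ _ "(r \<odot>\<^bsub>P\<^esub> a, r \<odot>\<^bsub>P\<^esub> b)"])
            (auto simp: hs fc gc V.smult_r_distr P.smult_closed)
      qed
      show "y = \<zero>\<^bsub>V\<^esub>" if y: "(\<zero>\<^bsub>V\<^esub>, y) \<in> \<Delta>" for y
      proof -
        obtain p where p: "(\<zero>\<^bsub>V\<^esub>, y) = (case p of (a, b) \<Rightarrow> (f a \<oplus>\<^bsub>V\<^esub> g b, f a))"
          "p \<in> carrier P \<times> carrier P"
          using y unfolding \<Delta>_def by (rule imageE)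
        obtain a b where "p = (a, b)" by (cases p)
        with p have ab: "a \<in> carrier P" "b \<in> carrier P" "f a \<oplus>\<^bsub>V\<^esub> g b = \<zero>\<^bsub>V\<^esub>" "y = f a"
          by simp_all
        then have "g b = \<ominus>\<^bsub>V\<^esub> f a"
          using V.M.minus_equality[of "g b" "f a"] fc gc by (simp add: V.M.a_comm)
        then have "g b \<in> ?S" using SD(5)[OF imageI[of a _ f]] ab(1) by metis
        then show ?thesis using disj[of b] ab g0 fc by simp
      qed
    qed blast
    then have "B (f a \<oplus>\<^bsub>V\<^esub> g b) = f a" if "a \<in> carrier P" "b \<in> carrier P" for a b
      using that by (force simp: \<Delta>_def)
    from this[of z "\<zero>\<^bsub>P\<^esub>"] this[of "\<zero>\<^bsub>P\<^esub>" z] have "B (f z) = f z" "B (g z) = \<zero>\<^bsub>V\<^esub>"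
      using f(2) by (simp_all add: f0 g0 fc gc)
    moreover have "T (B (f z)) = B (T (f z))"
      by (rule End_ring_commute[OF comm V(1) T B fc[OF f(2)]])
    ultimately show False using Tf[OF f(2)] g_ker[OF f(2)] z0 by simp
  qed
  let ?W = "restrict_scalars \<iota> V"
  interpret W: vectorspace F ?W by (rule vectorspace_restrict_scalars[OF V(1)])
  \<comment> \<open>The image of \<open>P\<close> is a subspace of the finite-dimensional
    \<open>V\<close>, and \<open>gS\<close> makes it invariant under T, so an eigenvector can be
    found in it although \<open>P\<close> itself is arbitrary.\<close>
  have W1: "VectorSpace.subspace F ?S ?W"
    unfolding subspace_def LinearCombinations.submodule_def
    using W.vectorspace_axioms W.module_axioms SD(1-4) closed
    by (auto simp: restrict_scalars_def)
  have W2: "T \<in> module_hom F ?W ?W"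
    using T closed by (auto simp: module_hom_def restrict_scalars_def)
  have W3: "T ` ?S \<subseteq> ?S" using Tf gS by auto
  have W4: "f z \<noteq> \<zero>\<^bsub>?W\<^esub>" using f(3) by (simp add: restrict_scalars_def)
  obtain c y where "c \<in> carrier F" "y \<in> ?S" "y \<noteq> \<zero>\<^bsub>?W\<^esub>" "T y = c \<odot>\<^bsub>?W\<^esub> y"
    using W.invariant_subspace_eigenvector[OF assms(1) V(2) W2 W1 W3 imageI[OF f(2)] W4] .
  then have c: "c \<in> carrier F" "y \<in> ?S" "y \<noteq> \<zero>\<^bsub>V\<^esub>" "T y = \<iota> c \<odot>\<^bsub>V\<^esub> y"
    by (simp_all add: restrict_scalars_def)
  then obtain t where t: "t \<in> carrier P" "y = f t" by blast
  \<comment> \<open>Since \<iota> c is central, multiplying \<open>f\<close> by it gives an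
    \<open>A\<close>-homomorphism, so the points where it agrees with \<open>g\<close> form a
    submodule. It contains \<open>t\<close>, because g t = T (f t) and f t is the
    eigenvector.\<close>
  let ?N = "{x \<in> carrier P. g x = \<iota> c \<odot>\<^bsub>V\<^esub> f x}"
  have "Module.submodule ?N A P"
  proof (rule P.submoduleI)
    fix r x assume r: "r \<in> carrier A" "x \<in> ?N"
    then have "r \<odot>\<^bsub>V\<^esub> (\<iota> c \<odot>\<^bsub>V\<^esub> f x) = \<iota> c \<odot>\<^bsub>V\<^esub> (r \<odot>\<^bsub>V\<^esub> f x)"
      using closed[OF c(1)] fc by (simp add: V.smult_assoc1[symmetric] central[OF c(1)])
    then show "r \<odot>\<^bsub>P\<^esub> x \<in> ?N" using r by (simp add: hs P.smult_closed)
  qed (use closed[OF c(1)] fc in \<open>auto simp: f0 g0 hs V.smult_r_zero V.smult_r_distr\<close>)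
  moreover have "t \<in> ?N" "t \<noteq> \<zero>\<^bsub>P\<^esub>" using c t Tf f0 by auto
  ultimately have "?N = carrier P" by (rule simple)
  then show thesis using that[OF c(1)] by blast
qed

end

section \<open>Extension of scalars\<close>

lemma frag_diff_in_free_Abelian_group:
  assumes "c \<in> carrier (free_Abelian_group I)" "d \<in> carrier (free_Abelian_group I)"
  shows "c - d \<in> carrier (free_Abelian_group I)"
  using assms keys_diff[of c d] by auto

lemma frag_extend_in_free_Abelian_group:
  assumes "c \<in> carrier (free_Abelian_group I)" "\<And>x. x \<in> I \<Longrightarrow> u x \<in> carrier (free_Abelian_group J)"
  shows "frag_extend u c \<in> carrier (free_Abelian_group J)"
proof -
  have "Poly_Mapping.keys (frag_extend u c) \<subseteq> (\<Union>x\<in>Poly_Mapping.keys c. Poly_Mapping.keys (u x))"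
    by (rule keys_frag_extend)
  also have "\<dots> \<subseteq> J" using assms by auto
  finally show ?thesis by simp
qed

lemma (in abelian_group) add_minus_minus:
  assumes "a \<in> carrier G" "b \<in> carrier G"
  shows "a \<oplus> b \<ominus> a \<ominus> b = \<zero>"
  using assms by (simp add: minus_eq a_comm[of a b] a_assoc r_neg)

section \<open>The tensor product as a quotient of a free abelian group\<close>

locale scalar_extension = R: ring R + S: ring S
  for R :: "('r, 'x) ring_scheme" and S :: "('s, 'y) ring_scheme" +
  fixes \<phi> :: "'r \<Rightarrow> 's"
  assumes hom: "\<phi> \<in> ring_hom R S"
begin

abbreviation chains :: "('r, 'm) module \<Rightarrow> ('s \<times> 'm \<Rightarrow>\<^sub>0 int) monoid"
  where "chains M \<equiv> free_Abelian_group (carrier S \<times> carrier M)"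

abbreviation "null M \<equiv> tensor_null R S \<phi> M"
abbreviation "cls M \<equiv> tensor_class R S \<phi> M"
abbreviation "ext M \<equiv> extend_scalars R S \<phi> M"
abbreviation "frag_map p q \<equiv> frag_extend (\<lambda>(s, x). frag_of (p s, q x))"

lemma closed: "r \<in> carrier R \<Longrightarrow> \<phi> r \<in> carrier S"
  using ring_hom_closed[OF hom] .

lemma tensor_relations_cases:
  assumes "c \<in> tensor_relations R S \<phi> M"
  obtains s t x where "s \<in> carrier S" "t \<in> carrier S" "x \<in> carrier M"
      "c = frag_of (s \<oplus>\<^bsub>S\<^esub> t, x) - frag_of (s, x) - frag_of (t, x)"
    | s x y where "s \<in> carrier S" "x \<in> carrier M" "y \<in> carrier M"
      "c = frag_of (s, x \<oplus>\<^bsub>M\<^esub> y) - frag_of (s, x) - frag_of (s, y)"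
    | s r x where "s \<in> carrier S" "r \<in> carrier R" "x \<in> carrier M"
      "c = frag_of (s \<otimes>\<^bsub>S\<^esub> \<phi> r, x) - frag_of (s, r \<odot>\<^bsub>M\<^esub> x)"
  using assms unfolding tensor_relations_def
  by (elim UnE CollectE exE conjE) (erule (3) that)+

lemma tensor_relationsI:
  "\<lbrakk>s \<in> carrier S; t \<in> carrier S; x \<in> carrier M\<rbrakk>
    \<Longrightarrow> frag_of (s \<oplus>\<^bsub>S\<^esub> t, x) - frag_of (s, x) - frag_of (t, x) \<in> tensor_relations R S \<phi> M"
  "\<lbrakk>s \<in> carrier S; x \<in> carrier M; y \<in> carrier M\<rbrakk>
    \<Longrightarrow> frag_of (s, x \<oplus>\<^bsub>M\<^esub> y) - frag_of (s, x) - frag_of (s, y) \<in> tensor_relations R S \<phi> M"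
  "\<lbrakk>s \<in> carrier S; r \<in> carrier R; x \<in> carrier M\<rbrakk>
    \<Longrightarrow> frag_of (s \<otimes>\<^bsub>S\<^esub> \<phi> r, x) - frag_of (s, r \<odot>\<^bsub>M\<^esub> x) \<in> tensor_relations R S \<phi> M"
  unfolding tensor_relations_def by blast+

lemma tensor_relations_subset:
  assumes "left_module R M"
  shows "tensor_relations R S \<phi> M \<subseteq> carrier (chains M)"
proof
  interpret M: left_module R M by fact
  fix c assume "c \<in> tensor_relations R S \<phi> M"
  then show "c \<in> carrier (chains M)"
    by (cases rule: tensor_relations_cases)
      (simp_all add: frag_diff_in_free_Abelian_group closed M.smult_closed
        del: carrier_free_Abelian_group_iff)
qed

lemma subgroup_null:
  assumes "left_module R M"
  shows "subgroup (null M) (chains M)"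
  unfolding tensor_null_def
  by (rule group.generate_is_subgroup[OF group_free_Abelian_group tensor_relations_subset[OF assms]])

lemma normal_null:
  assumes "left_module R M"
  shows "null M \<lhd> chains M"
  using comm_group.normal_iff_subgroup[OF abelian_free_Abelian_group] subgroup_null[OF assms] by blast

text \<open>Induction over the generated subgroup, with its product and inverse spelt as addition
  and negation of finitely supported functions.\<close>

lemma null_induct [consumes 2, case_names zero rel minus add]:
  assumes "left_module R M" "c \<in> null M"
    and "P 0" "\<And>c. c \<in> tensor_relations R S \<phi> M \<Longrightarrow> P c"
    and "\<And>c. c \<in> null M \<Longrightarrow> P c \<Longrightarrow> P (- c)"
    and "\<And>c d. c \<in> null M \<Longrightarrow> d \<in> null M \<Longrightarrow> P c \<Longrightarrow> P d \<Longrightarrow> P (c + d)"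
  shows "P c"
  using assms(2) unfolding tensor_null_def
proof (induction rule: generate.induct)
  case (inv h)
  have "h \<in> carrier (chains M)" using inv tensor_relations_subset[OF assms(1)] by blast
  then show ?case
    using assms(4,5) inv by (auto simp: tensor_null_def intro: generate.incl)
qed (use assms(3-6) in \<open>auto simp: tensor_null_def\<close>)

text \<open>The kernel is a subgroup, so it contains all of \<open>null M\<close> once it contains
  the generating relations.\<close>

lemma hom_null:
  assumes "left_module R M" "group B" "h \<in> hom (chains M) B"
    and rel: "\<And>c. c \<in> tensor_relations R S \<phi> M \<Longrightarrow> h c = \<one>\<^bsub>B\<^esub>"
  shows "null M \<subseteq> kernel (chains M) B h"
proof -
  interpret group_hom "chains M" B h
    using assms(2,3) by (simp add: group_hom_def group_hom_axioms_def)
  show ?thesis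
    unfolding tensor_null_def
    using tensor_relations_subset[OF assms(1)] rel
    by (intro group.generate_subgroup_incl[OF group_free_Abelian_group _ subgroup_kernel])
      (auto simp: kernel_def simp del: carrier_free_Abelian_group_iff)
qed

lemma cls_eqI:
  assumes "left_module R M" "d \<in> carrier (chains M)" "n \<in> null M"
  shows "cls M (n + d) = cls M d"
proof -
  have "n + d \<in> null M #>\<^bsub>chains M\<^esub> d" using assms(3) by (auto simp: r_coset_def)
  from group.repr_independence[OF group_free_Abelian_group this assms(2) subgroup_null[OF assms(1)]]
  show ?thesis by (simp add: tensor_class_def)
qed

lemma frag_map_in_chains:
  assumes "c \<in> carrier (chains M)" "p \<in> carrier S \<rightarrow> carrier S" "q \<in> carrier M \<rightarrow> carrier M'"
  shows "frag_map p q c \<in> carrier (chains M')"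
  using assms by (intro frag_extend_in_free_Abelian_group[OF assms(1)]) auto

text \<open>This is what makes p \<otimes> q well defined: each of the three kinds of relation is
  sent to one of the same kind. Left multiplication with the identity gives the action of
  \<open>S\<close>, and the identity with a homomorphism gives functoriality.\<close>

lemma frag_map_null:
  assumes "left_module R M" "left_module R M'"
    and p: "p \<in> carrier S \<rightarrow> carrier S"
      "\<And>s t. s \<in> carrier S \<Longrightarrow> t \<in> carrier S \<Longrightarrow> p (s \<oplus>\<^bsub>S\<^esub> t) = p s \<oplus>\<^bsub>S\<^esub> p t"
      "\<And>s r. s \<in> carrier S \<Longrightarrow> r \<in> carrier R \<Longrightarrow> p (s \<otimes>\<^bsub>S\<^esub> \<phi> r) = p s \<otimes>\<^bsub>S\<^esub> \<phi> r"
    and q: "q \<in> module_hom R M M'" and c: "c \<in> null M"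
  shows "frag_map p q c \<in> null M'"
proof -
  interpret N: subgroup "null M'" "chains M'" by (rule subgroup_null[OF assms(2)])
  show ?thesis
    using assms(1) c
  proof (induction rule: null_induct)
    case zero
    then show ?case using N.one_closed by simp
  next
    case (rel c)
    have "frag_map p q c \<in> tensor_relations R S \<phi> M'"
      using rel
      by (cases rule: tensor_relations_cases)
        (simp_all add: frag_extend_diff p(2,3) module_hom_add[OF q] module_hom_smult[OF q]
          funcset_mem[OF p(1)] module_hom_in_carrier[OF q] tensor_relationsI)
    then show ?case by (simp add: tensor_null_def generate.incl)
  next
    case (minus c)
    then have "inv\<^bsub>chains M'\<^esub> frag_map p q c = - frag_map p q c"
      using subsetD[OF N.subset, of "frag_map p q c"] by (intro inv_free_Abelian_group) simp
    then show ?case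
      using N.m_inv_closed[of "frag_map p q c"] minus by (simp add: frag_extend_minus)
  next
    case (add c d)
    then show ?case using N.m_closed by (auto simp: frag_extend_add)
  qed
qed

text \<open>Members of the coset have the form n + d with n in \<open>null M\<close>, and the image
  of n is null again, so all sets in the union coincide. There is at least one of them, as 0 is in
  \<open>null M\<close>. This evaluates the unions by which the scalar action and the induced maps
  are defined.\<close>

lemma Union_cls_frag_map:
  assumes "left_module R M" "left_module R M'"
    and p: "p \<in> carrier S \<rightarrow> carrier S"
      "\<And>s t. s \<in> carrier S \<Longrightarrow> t \<in> carrier S \<Longrightarrow> p (s \<oplus>\<^bsub>S\<^esub> t) = p s \<oplus>\<^bsub>S\<^esub> p t"
      "\<And>s r. s \<in> carrier S \<Longrightarrow> r \<in> carrier R \<Longrightarrow> p (s \<otimes>\<^bsub>S\<^esub> \<phi> r) = p s \<otimes>\<^bsub>S\<^esub> \<phi> r"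
    and q: "q \<in> module_hom R M M'" and d: "d \<in> carrier (chains M)"
  shows "(\<Union>c\<in>cls M d. cls M' (frag_map p q c)) = cls M' (frag_map p q d)"
proof -
  have "cls M' (frag_map p q (n + d)) = cls M' (frag_map p q d)" if "n \<in> null M" for n
    using frag_map_null[OF assms(1-6) that] frag_map_in_chains[OF d p(1) module_hom_closed[OF q]]
    by (simp add: frag_extend_add cls_eqI[OF assms(2)])
  moreover have "cls M d = (\<lambda>n. n + d) ` null M"
    by (auto simp: tensor_class_def r_coset_def)
  moreover have "0 \<in> null M" using subgroup.one_closed[OF subgroup_null[OF assms(1)]] by simp
  ultimately show ?thesis by auto
qed

lemma carrier_ext: "carrier (ext M) = cls M ` carrier (chains M)"
  by (simp add: extend_scalars_def carrier_FactGroup tensor_class_def)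

lemma add_ext:
  assumes "left_module R M" "c \<in> carrier (chains M)" "d \<in> carrier (chains M)"
  shows "cls M c \<oplus>\<^bsub>ext M\<^esub> cls M d = cls M (c + d)"
  using normal.rcos_sum[OF normal_null[OF assms(1)] assms(2,3)]
  by (simp add: extend_scalars_def tensor_class_def)

lemma smult_ext:
  assumes "left_module R M" "s \<in> carrier S" "c \<in> carrier (chains M)"
  shows "s \<odot>\<^bsub>ext M\<^esub> cls M c = cls M (frag_map (\<lambda>t. s \<otimes>\<^bsub>S\<^esub> t) (\<lambda>x. x) c)"
proof -
  have "(\<lambda>x. x) \<in> module_hom R M M" by (simp add: module_hom_def)
  then show ?thesis
    using Union_cls_frag_map[OF assms(1,1), of "\<lambda>t. s \<otimes>\<^bsub>S\<^esub> t" "\<lambda>x. x" c] assms(2,3)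
    by (simp add: extend_scalars_def S.r_distr S.m_assoc closed Pi_iff)
qed

lemma extend_scalars_map_cls:
  assumes "left_module R M" "left_module R M'" "q \<in> module_hom R M M'" "c \<in> carrier (chains M)"
  shows "extend_scalars_map R S \<phi> M' q (cls M c) = cls M' (frag_map (\<lambda>s. s) q c)"
  using Union_cls_frag_map[OF assms(1,2), of "\<lambda>s. s" q c] assms(3,4)
  by (simp add: extend_scalars_map_def)

section \<open>The adjunction between extension and restriction of scalars\<close>

lemma cls_relation:
  assumes "left_module R M" "c - d \<in> null M" "d \<in> carrier (chains M)"
  shows "cls M c = cls M d"
  using cls_eqI[OF assms(1,3,2)] by simp

text \<open>Composition with the unit of the adjunction, x \<mapsto> 1 \<otimes> x, which is
  \<open>R\<close>-linear because 1 \<otimes> r x = \<phi> r \<otimes> x.\<close>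

lemma module_hom_ext_unit:
  assumes M: "left_module R M" and h: "h \<in> module_hom S (ext M) V"
  shows "(\<lambda>x. h (cls M (frag_of (\<one>\<^bsub>S\<^esub>, x)))) \<in> module_hom R M (restrict_scalars \<phi> V)"
proof -
  interpret M: left_module R M by fact
  have rel: "c \<in> null M" if "c \<in> tensor_relations R S \<phi> M" for c
    using that by (simp add: tensor_null_def generate.incl)
  have add: "cls M (frag_of (\<one>\<^bsub>S\<^esub>, x \<oplus>\<^bsub>M\<^esub> y)) = cls M (frag_of (\<one>\<^bsub>S\<^esub>, x)) \<oplus>\<^bsub>ext M\<^esub> cls M (frag_of (\<one>\<^bsub>S\<^esub>, y))"
    if "x \<in> carrier M" "y \<in> carrier M" for x y
  proof -
    have "cls M (frag_of (\<one>\<^bsub>S\<^esub>, x \<oplus>\<^bsub>M\<^esub> y)) = cls M (frag_of (\<one>\<^bsub>S\<^esub>, x) + frag_of (\<one>\<^bsub>S\<^esub>, y))"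
    proof (rule cls_relation[OF M])
      show "frag_of (\<one>\<^bsub>S\<^esub>, x \<oplus>\<^bsub>M\<^esub> y) - (frag_of (\<one>\<^bsub>S\<^esub>, x) + frag_of (\<one>\<^bsub>S\<^esub>, y)) \<in> null M"
        using rel[OF tensor_relationsI(2)[OF S.one_closed that]] by (simp only: diff_diff_eq)
      show "frag_of (\<one>\<^bsub>S\<^esub>, x) + frag_of (\<one>\<^bsub>S\<^esub>, y) \<in> carrier (chains M)"
        using that keys_add[of "frag_of (\<one>\<^bsub>S\<^esub>, x)" "frag_of (\<one>\<^bsub>S\<^esub>, y)"] by auto
    qed
    then show ?thesis using that by (simp add: add_ext[OF M])
  qed
  have smult: "cls M (frag_of (\<one>\<^bsub>S\<^esub>, r \<odot>\<^bsub>M\<^esub> x)) = \<phi> r \<odot>\<^bsub>ext M\<^esub> cls M (frag_of (\<one>\<^bsub>S\<^esub>, x))"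
    if "r \<in> carrier R" "x \<in> carrier M" for r x
    using cls_relation[OF M rel[OF tensor_relationsI(3)[of "\<one>\<^bsub>S\<^esub>" r x M]]] that
    by (simp add: smult_ext[OF M] closed M.smult_closed)
  have "cls M (frag_of (\<one>\<^bsub>S\<^esub>, x)) \<in> carrier (ext M)" if "x \<in> carrier M" for x
    using that by (auto simp: carrier_ext)
  then show ?thesis
    using module_hom_in_carrier[OF h] closed unfolding module_hom_def[of R]
    by (auto simp: restrict_scalars_def add smult module_hom_add[OF h] module_hom_smult[OF h])
qed

text \<open>The map s \<otimes> x \<mapsto> s g(x). It is prescribed on the generators of the free
  abelian group; the relations die by the module axioms and the \<open>R\<close>-linearity of g, so
  it descends to the quotient.\<close>

lemma module_hom_ext_adjoint:
  assumes M: "left_module R M" and V: "left_module S V"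
    and g: "g \<in> module_hom R M (restrict_scalars \<phi> V)"
  obtains h where "h \<in> module_hom S (ext M) V"
    "\<And>s x. s \<in> carrier S \<Longrightarrow> x \<in> carrier M \<Longrightarrow> h (cls M (frag_of (s, x))) = s \<odot>\<^bsub>V\<^esub> g x"
proof -
  interpret M: left_module R M by fact
  interpret V: left_module S V by fact
  have gV: "g x \<in> carrier V" if "x \<in> carrier M" for x
    using module_hom_in_carrier[OF g that] by (simp add: restrict_scalars_def)
  have g_add: "g (x \<oplus>\<^bsub>M\<^esub> y) = g x \<oplus>\<^bsub>V\<^esub> g y" if "x \<in> carrier M" "y \<in> carrier M" for x y
    using module_hom_add[OF g that] by (simp add: restrict_scalars_def)
  have g_smult: "g (r \<odot>\<^bsub>M\<^esub> x) = \<phi> r \<odot>\<^bsub>V\<^esub> g x" if "r \<in> carrier R" "x \<in> carrier M" for r x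
    using module_hom_smult[OF g that] by (simp add: restrict_scalars_def)
  have "(\<lambda>(s, x). s \<odot>\<^bsub>V\<^esub> g x) ` (carrier S \<times> carrier M) \<subseteq> carrier (add_monoid V)"
    by (auto simp: gV V.smult_closed)
  then obtain k where k: "k \<in> hom (chains M) (add_monoid V)"
    and k_of: "\<And>p. p \<in> carrier S \<times> carrier M \<Longrightarrow> k (frag_of p) = (\<lambda>(s, x). s \<odot>\<^bsub>V\<^esub> g x) p"
    using comm_group.free_Abelian_group_universal[OF V.M.a_comm_group] by metis
  interpret k: group_hom "chains M" "add_monoid V" k
    using k V.M.a_group by (simp add: group_hom_def group_hom_axioms_def)
  have k_closed: "k c \<in> carrier V" if "c \<in> carrier (chains M)" for c
    using k.hom_closed[OF that] by simp
  have k_diff: "k (c - d) = k c \<ominus>\<^bsub>V\<^esub> k d"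
    if "c \<in> carrier (chains M)" "d \<in> carrier (chains M)" for c d
  proof -
    have "- d \<in> carrier (chains M)" using that by simp
    then show ?thesis
      using k.hom_mult[of c "- d"] k.hom_inv[of d] that
      by (simp add: V.M.minus_eq a_inv_def)
  qed
  have "null M \<subseteq> kernel (chains M) (add_monoid V) k"
  proof (rule hom_null[OF M V.M.a_group k])
    fix c assume "c \<in> tensor_relations R S \<phi> M"
    then show "k c = \<one>\<^bsub>add_monoid V\<^esub>"
    proof (cases rule: tensor_relations_cases)
      case (1 s t x)
      then show ?thesis using gV[of x]
        by (simp add: k_diff frag_diff_in_free_Abelian_group k_of V.smult_l_distr V.smult_closed
            V.M.add_minus_minus del: carrier_free_Abelian_group_iff) 
    next
      case (2 s x y)
      then show ?thesis using gV[of x] gV[of y]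
        by (simp add: k_diff frag_diff_in_free_Abelian_group k_of V.smult_r_distr V.smult_closed g_add
            V.M.add_minus_minus del: carrier_free_Abelian_group_iff) 
    next
      case (3 s r x)
      then show ?thesis using gV[of x] closed[of r]
        by (simp add: k_diff k_of V.smult_assoc1 g_smult M.smult_closed V.smult_closed
            del: carrier_free_Abelian_group_iff)
    qed
  qed
  from k.FactGroup_universal_kernel[OF normal_null[OF M] this]
  obtain h where h: "h \<in> hom (chains M Mod null M) (add_monoid V)"
    and "\<And>c. c \<in> carrier (chains M) \<Longrightarrow> h (null M #>\<^bsub>chains M\<^esub> c) = k c" by metis
  then have hk: "h (cls M c) = k c" if "c \<in> carrier (chains M)" for c
    using that by (simp add: tensor_class_def)
  \<comment> \<open>Known on generators only, where it is associativity of the action; it spreads to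
    all chains through differences.\<close>
  have k_smult: "k (frag_map (\<lambda>t. s \<otimes>\<^bsub>S\<^esub> t) (\<lambda>x. x) c) = s \<odot>\<^bsub>V\<^esub> k c"
    if s: "s \<in> carrier S" and c: "c \<in> carrier (chains M)" for s c
  proof -
    have "Poly_Mapping.keys c \<subseteq> carrier S \<times> carrier M" using c by simp
    then show ?thesis
    proof (induction rule: free_Abelian_group_induct[consumes 1, case_names zero diff gen])
      case zero
      then show ?case using k.hom_one s by (simp add: V.smult_r_zero)
    next
      case (diff c d)
      have cd: "c \<in> carrier (chains M)" "d \<in> carrier (chains M)" using diff by auto
      then have "frag_map (\<lambda>t. s \<otimes>\<^bsub>S\<^esub> t) (\<lambda>x. x) c \<in> carrier (chains M)"
        "frag_map (\<lambda>t. s \<otimes>\<^bsub>S\<^esub> t) (\<lambda>x. x) d \<in> carrier (chains M)"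
        using s by (auto intro!: frag_map_in_chains simp del: carrier_free_Abelian_group_iff)
      then show ?case
        using diff cd s k_closed V.smult_minus_one
        by (simp add: frag_extend_diff k_diff V.M.minus_eq V.smult_r_distr V.smult_r_minus
            del: carrier_free_Abelian_group_iff)
    next
      case (gen p)
      then show ?case using s gV by (auto simp: k_of V.smult_assoc1)
    qed
  qed
  have "c + d \<in> carrier (chains M) \<and> k (c + d) = k c \<oplus>\<^bsub>V\<^esub> k d"
    if "c \<in> carrier (chains M)" "d \<in> carrier (chains M)" for c d
    using k.hom_mult[OF that] group.is_monoid[OF group_free_Abelian_group, THEN monoid.m_closed, OF that]
    by simp
  moreover have "frag_map (\<lambda>t. s \<otimes>\<^bsub>S\<^esub> t) (\<lambda>x. x) c \<in> carrier (chains M)"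
    if "s \<in> carrier S" "c \<in> carrier (chains M)" for s c
    using that by (intro frag_map_in_chains) auto
  ultimately have "h \<in> module_hom S (ext M) V"
    unfolding module_hom_def carrier_ext
    using k_closed
    by (auto simp: hk add_ext[OF M] smult_ext[OF M] k_smult simp del: carrier_free_Abelian_group_iff)
  moreover have "h (cls M (frag_of (s, x))) = s \<odot>\<^bsub>V\<^esub> g x" if "s \<in> carrier S" "x \<in> carrier M" for s x
    using that by (simp add: hk k_of)
  ultimately show thesis using that by blast
qed

end

text \<open>Every axiom is an identity, or the existence of a negative, and is carried over by
  lifting elements along p. No structure on \<open>N\<close> is presupposed, so p must also be told
  to respect zero. It serves to recognise a quotient as a module.\<close>

lemma left_module_surjective_image:
  assumes "left_module R M"
    and p: "p ` carrier M = carrier N" "p \<zero>\<^bsub>M\<^esub> = \<zero>\<^bsub>N\<^esub>"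
      "\<And>x y. x \<in> carrier M \<Longrightarrow> y \<in> carrier M \<Longrightarrow> p (x \<oplus>\<^bsub>M\<^esub> y) = p x \<oplus>\<^bsub>N\<^esub> p y"
      "\<And>r x. r \<in> carrier R \<Longrightarrow> x \<in> carrier M \<Longrightarrow> p (r \<odot>\<^bsub>M\<^esub> x) = r \<odot>\<^bsub>N\<^esub> p x"
  shows "left_module R N"
proof -
  interpret M: left_module R M by fact
  have pc: "p x \<in> carrier N" if "x \<in> carrier M" for x using that p(1) by blast
  have ex: "\<exists>x\<in>carrier M. y = p x" if "y \<in> carrier N" for y using that p(1) by blast
  have "abelian_group N"
  proof (rule abelian_groupI)
    show "\<zero>\<^bsub>N\<^esub> \<in> carrier N" using pc[of "\<zero>\<^bsub>M\<^esub>"] p(2) by simp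
  next
    fix a b assume "a \<in> carrier N" "b \<in> carrier N"
    then obtain x y where "x \<in> carrier M" "a = p x" "y \<in> carrier M" "b = p y" using ex by metis
    then show "a \<oplus>\<^bsub>N\<^esub> b \<in> carrier N" "a \<oplus>\<^bsub>N\<^esub> b = b \<oplus>\<^bsub>N\<^esub> a"
      by (simp_all add: p(3)[symmetric] pc M.a_comm)
  next
    fix a b c assume "a \<in> carrier N" "b \<in> carrier N" "c \<in> carrier N"
    then obtain x y z where "x \<in> carrier M" "a = p x" "y \<in> carrier M" "b = p y" "z \<in> carrier M" "c = p z"
      using ex by metis
    then show "(a \<oplus>\<^bsub>N\<^esub> b) \<oplus>\<^bsub>N\<^esub> c = a \<oplus>\<^bsub>N\<^esub> (b \<oplus>\<^bsub>N\<^esub> c)"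
      by (simp add: p(3)[symmetric] M.a_assoc)
  next
    fix a assume "a \<in> carrier N"
    then obtain x where x: "x \<in> carrier M" "a = p x" using ex by metis
    then show "\<zero>\<^bsub>N\<^esub> \<oplus>\<^bsub>N\<^esub> a = a" by (simp add: p(2,3)[symmetric])
    show "\<exists>y\<in>carrier N. y \<oplus>\<^bsub>N\<^esub> a = \<zero>\<^bsub>N\<^esub>"
      using x by (intro bexI[of _ "p (\<ominus>\<^bsub>M\<^esub> x)"]) (simp_all add: p(2,3)[symmetric] pc M.M.l_neg)
  qed
  moreover have "left_module_axioms R N"
  proof
    fix r s a b assume "r \<in> carrier R" and a: "a \<in> carrier N"
    obtain x where x: "x \<in> carrier M" "a = p x" using ex[OF a] by metis
    show "r \<odot>\<^bsub>N\<^esub> a \<in> carrier N"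
      using x \<open>r \<in> carrier R\<close> by (simp add: p(4)[symmetric] pc M.smult_closed)
    show "(r \<oplus>\<^bsub>R\<^esub> s) \<odot>\<^bsub>N\<^esub> a = r \<odot>\<^bsub>N\<^esub> a \<oplus>\<^bsub>N\<^esub> s \<odot>\<^bsub>N\<^esub> a" if "s \<in> carrier R"
      using x \<open>r \<in> carrier R\<close> that by (simp add: p(3,4)[symmetric] M.smult_closed M.smult_l_distr)
    show "(r \<otimes>\<^bsub>R\<^esub> s) \<odot>\<^bsub>N\<^esub> a = r \<odot>\<^bsub>N\<^esub> (s \<odot>\<^bsub>N\<^esub> a)" if "s \<in> carrier R"
      using x \<open>r \<in> carrier R\<close> that by (simp add: p(4)[symmetric] M.smult_closed M.smult_assoc1)
    show "r \<odot>\<^bsub>N\<^esub> (a \<oplus>\<^bsub>N\<^esub> b) = r \<odot>\<^bsub>N\<^esub> a \<oplus>\<^bsub>N\<^esub> r \<odot>\<^bsub>N\<^esub> b" if b: "b \<in> carrier N"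
    proof -
      obtain y where "y \<in> carrier M" "b = p y" using ex[OF b] by metis
      then show ?thesis
        using x \<open>r \<in> carrier R\<close> by (simp add: p(3,4)[symmetric] M.smult_closed M.smult_r_distr)
    qed
  next
    fix a assume a: "a \<in> carrier N"
    obtain x where "x \<in> carrier M" "a = p x" using ex[OF a] by metis
    then show "\<one>\<^bsub>R\<^esub> \<odot>\<^bsub>N\<^esub> a = a" by (simp add: p(4)[symmetric] M.smult_one)
  qed
  ultimately show ?thesis using M.R.ring_axioms by (simp add: left_module_def)
qed

text \<open>The cokernel is carried by a set of coset representatives, so that its elements have the same
  type as those of \<open>N\<close>.\<close>

lemma short_exact_cokernel:
  fixes N :: "('r, 'v) module"
  assumes K: "left_module R K" and N: "left_module R N"
    and f: "f \<in> module_hom R K N" "inj_on f (carrier K)"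
  obtains C :: "('r, 'v) module" and p where "short_exact R K N C f p"
proof -
  interpret N: left_module R N by fact
  define I where "I = f ` carrier K"
  have "Module.submodule I R N" unfolding I_def by (rule submodule_image[OF K N f(1)])
  note I = N.submoduleD[OF this]
  define rep where "rep x = (SOME y. y \<in> carrier N \<and> y \<ominus>\<^bsub>N\<^esub> x \<in> I)" for x
  have rep: "rep x \<in> carrier N" "rep x \<ominus>\<^bsub>N\<^esub> x \<in> I" if "x \<in> carrier N" for x
    using that I(2) someI[of "\<lambda>y. y \<in> carrier N \<and> y \<ominus>\<^bsub>N\<^esub> x \<in> I" x]
    by (auto simp: rep_def N.M.minus_eq N.M.r_neg)
  \<comment> \<open>Congruent elements define the same predicate, so the choice operator picks the
    same representative.\<close>
  have rep_eqI: "rep x = rep y" if "x \<in> carrier N" "y \<in> carrier N" "x \<ominus>\<^bsub>N\<^esub> y \<in> I" for x y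
  proof -
    have "z \<ominus>\<^bsub>N\<^esub> x \<in> I \<longleftrightarrow> z \<ominus>\<^bsub>N\<^esub> y \<in> I" if z: "z \<in> carrier N" for z
    proof -
      have "z \<ominus>\<^bsub>N\<^esub> y = (z \<ominus>\<^bsub>N\<^esub> x) \<oplus>\<^bsub>N\<^esub> (x \<ominus>\<^bsub>N\<^esub> y)"
        using z \<open>x \<in> carrier N\<close> \<open>y \<in> carrier N\<close>
        by (simp add: N.M.minus_eq N.M.a_assoc N.M.r_neg1)
      moreover have "z \<ominus>\<^bsub>N\<^esub> x = (z \<ominus>\<^bsub>N\<^esub> y) \<oplus>\<^bsub>N\<^esub> \<ominus>\<^bsub>N\<^esub> (x \<ominus>\<^bsub>N\<^esub> y)"
        using z \<open>x \<in> carrier N\<close> \<open>y \<in> carrier N\<close>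
        by (simp add: N.M.minus_eq N.M.add_minus_interchange N.M.l_neg)
      ultimately show ?thesis using I(3,5) \<open>x \<ominus>\<^bsub>N\<^esub> y \<in> I\<close> by metis
    qed
    then show ?thesis unfolding rep_def by (metis (lifting))
  qed
  have rep_add: "rep (x \<oplus>\<^bsub>N\<^esub> y) = rep (rep x \<oplus>\<^bsub>N\<^esub> rep y)" if "x \<in> carrier N" "y \<in> carrier N" for x y
  proof (rule rep_eqI[symmetric])
    have "rep x \<oplus>\<^bsub>N\<^esub> rep y \<ominus>\<^bsub>N\<^esub> (x \<oplus>\<^bsub>N\<^esub> y) = (rep x \<ominus>\<^bsub>N\<^esub> x) \<oplus>\<^bsub>N\<^esub> (rep y \<ominus>\<^bsub>N\<^esub> y)"
      using that rep(1) by (simp add: N.M.minus_eq N.M.add_minus_interchange)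
    then show "rep x \<oplus>\<^bsub>N\<^esub> rep y \<ominus>\<^bsub>N\<^esub> (x \<oplus>\<^bsub>N\<^esub> y) \<in> I" using that rep(2) I(3) by simp
  qed (use that rep(1) in auto)
  have rep_smult: "rep (r \<odot>\<^bsub>N\<^esub> x) = rep (r \<odot>\<^bsub>N\<^esub> rep x)" if "r \<in> carrier R" "x \<in> carrier N" for r x
  proof (rule rep_eqI[symmetric])
    have "r \<odot>\<^bsub>N\<^esub> rep x \<ominus>\<^bsub>N\<^esub> r \<odot>\<^bsub>N\<^esub> x = r \<odot>\<^bsub>N\<^esub> (rep x \<ominus>\<^bsub>N\<^esub> x)"
      using that rep(1) by (simp add: N.M.minus_eq N.smult_r_distr N.smult_r_minus)
    then show "r \<odot>\<^bsub>N\<^esub> rep x \<ominus>\<^bsub>N\<^esub> r \<odot>\<^bsub>N\<^esub> x \<in> I" using that rep(2) I(4) by simp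
  qed (use that rep(1) in \<open>auto simp: N.smult_closed\<close>)
  \<comment> \<open>The operations of \<open>N\<close> followed by a return to representatives; the
    two undefined fields carry no meaning in a module.\<close>
  define C :: "('r, 'v) module" where
    "C = \<lparr>carrier = rep ` carrier N, monoid.mult = undefined, one = undefined,
      ring.zero = rep \<zero>\<^bsub>N\<^esub>, ring.add = (\<lambda>x y. rep (x \<oplus>\<^bsub>N\<^esub> y)), smult = (\<lambda>r x. rep (r \<odot>\<^bsub>N\<^esub> x))\<rparr>"
  have C: "left_module R C"
    by (rule left_module_surjective_image[OF N, of rep]) (simp_all add: C_def rep_add[symmetric] rep_smult[symmetric])
  have p: "rep \<in> module_hom R N C"
    by (auto simp: module_hom_def C_def rep_add[symmetric] rep_smult[symmetric])
  have minus_zero: "\<ominus>\<^bsub>N\<^esub> \<zero>\<^bsub>N\<^esub> = \<zero>\<^bsub>N\<^esub>" by (rule N.M.minus_equality) simp_all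
  \<comment> \<open>The chosen representative of 0 lies in \<open>I\<close> but need not be 0, so x
    is recovered as rep x - (rep x - x), a difference of two elements of \<open>I\<close>.\<close>
  have "x \<in> I" if x: "x \<in> carrier N" "rep x = rep \<zero>\<^bsub>N\<^esub>" for x
  proof -
    have "rep x \<in> I" using rep[OF N.M.zero_closed] x(2) by (simp add: N.M.minus_eq minus_zero)
    moreover have "\<ominus>\<^bsub>N\<^esub> (rep x \<ominus>\<^bsub>N\<^esub> x) \<in> I" using rep(2)[OF x(1)] by (rule I(5))
    ultimately have "rep x \<oplus>\<^bsub>N\<^esub> \<ominus>\<^bsub>N\<^esub> (rep x \<ominus>\<^bsub>N\<^esub> x) \<in> I" by (rule I(3))
    then show ?thesis
      using rep(1)[OF x(1)] x(1) by (simp add: N.M.minus_eq N.M.minus_add N.M.a_assoc[symmetric] N.M.r_neg)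
  qed
  moreover have "rep x = rep \<zero>\<^bsub>N\<^esub>" if "x \<in> I" for x
    using that I(1)
    by (intro rep_eqI) (auto simp: N.M.minus_eq minus_zero)
  ultimately have "rep x = rep \<zero>\<^bsub>N\<^esub> \<longleftrightarrow> x \<in> I" if "x \<in> carrier N" for x
    using that by blast
  then have "a_kernel N C rep = {x \<in> carrier N. x \<in> I}"
    by (simp add: a_kernel_def kernel_def C_def cong: conj_cong)
  then have "I = a_kernel N C rep" using I(1) by blast
  then have "short_exact R K N C f rep"
    using K N C f p by (simp add: short_exact_def I_def C_def)
  then show thesis using that by blast
qed

text \<open>Frobenius reciprocity turns an extension problem along an injection \<open>f\<close> of \<open>R\<close>-modules into one
  along the induced map on the extensions of scalars, which is injective by exactness.\<close>

lemma (in scalar_extension) relatively_injective_restrict_scalars: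
  fixes N :: "('r, 'v) module"
  assumes exact: "\<And>(A :: ('r, 'v) module) (B :: ('r, 'v) module) (C :: ('r, 'v) module) f g.
      short_exact R A B C f g \<Longrightarrow>
      short_exact S (ext A) (ext B) (ext C) (extend_scalars_map R S \<phi> B f) (extend_scalars_map R S \<phi> C g)"
    and N: "left_module R N" and V: "left_module S V" and inj: "relatively_injective S V (ext N)"
  shows "relatively_injective R (restrict_scalars \<phi> V) N"
  unfolding relatively_injective_def
proof (intro allI impI)
  interpret V: left_module S V by fact
  fix K :: "('r, 'v) module" and f g
  assume K: "left_module R K" and f: "f \<in> module_hom R K N" "inj_on f (carrier K)"
    and g: "g \<in> module_hom R K (restrict_scalars \<phi> V)"
  let ?F = "extend_scalars_map R S \<phi> N f"
  \<comment> \<open>Exactness is available for short exact sequences only, so \<open>f\<close> is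
    completed to one; of the result, only the injectivity at the left end matters.\<close>
  obtain C :: "('r, 'v) module" and p where "short_exact R K N C f p"
    using short_exact_cokernel[OF K N f] .
  from exact[OF this] have F: "left_module S (ext K)" "?F \<in> module_hom S (ext K) (ext N)" "inj_on ?F (carrier (ext K))"
    by (auto simp: short_exact_def)
  obtain g' where g': "g' \<in> module_hom S (ext K) V"
    "\<And>s x. s \<in> carrier S \<Longrightarrow> x \<in> carrier K \<Longrightarrow> g' (cls K (frag_of (s, x))) = s \<odot>\<^bsub>V\<^esub> g x"
    using module_hom_ext_adjoint[OF K V g] by blast
  obtain h where h: "h \<in> module_hom S (ext N) V" "\<forall>u\<in>carrier (ext K). h (?F u) = g' u"
    using inj F g'(1) unfolding relatively_injective_def by blast
  show "\<exists>h\<in>module_hom R N (restrict_scalars \<phi> V). \<forall>x\<in>carrier K. h (f x) = g x"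
  \<comment> \<open>The extension is x \<mapsto> h (1 \<otimes> x); on the image of f it gives h (1
    \<otimes> f x) = g' (1 \<otimes> x) = 1 g(x).\<close>
  proof (intro bexI[OF _ module_hom_ext_unit[OF N h(1)]] ballI)
    fix x assume x: "x \<in> carrier K"
    have u: "frag_of (\<one>\<^bsub>S\<^esub>, x) \<in> carrier (chains K)" using x by simp
    then have "h (?F (cls K (frag_of (\<one>\<^bsub>S\<^esub>, x)))) = g' (cls K (frag_of (\<one>\<^bsub>S\<^esub>, x)))"
      using h(2) unfolding carrier_ext by blast
    then show "h (cls N (frag_of (\<one>\<^bsub>S\<^esub>, f x))) = g x"
      using x module_hom_in_carrier[OF g x]
      by (simp add: extend_scalars_map_cls[OF K N f(1) u] g'(2) V.smult_one restrict_scalars_def)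
  qed
qed

section \<open>Group rings\<close>

context
  fixes F :: "('f, 'x) ring_scheme" and G :: "('g, 'y) monoid_scheme"
  assumes F: "field F" and G: "group G"
begin

interpretation F: field F by (rule F)
interpretation G: group G by (rule G)

lemma group_ring_const_mult:
  assumes "c \<in> carrier F" "a \<in> carrier (group_ring F G)"
  shows "group_ring_const F G c \<otimes>\<^bsub>group_ring F G\<^esub> a = (\<lambda>g. c \<otimes>\<^bsub>F\<^esub> a g)"
proof
  fix g
  have a: "\<And>g. g \<in> carrier G \<Longrightarrow> a g \<in> carrier F" "\<And>g. g \<notin> carrier G \<Longrightarrow> a g = \<zero>\<^bsub>F\<^esub>"
    using assms(2) by (auto simp: group_ring_def)
  show "(group_ring_const F G c \<otimes>\<^bsub>group_ring F G\<^esub> a) g = c \<otimes>\<^bsub>F\<^esub> a g"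
  \<comment> \<open>The convolution runs over the support of the left factor, which is empty for c =
    0 and consists of the identity otherwise.\<close>
  proof (cases "c = \<zero>\<^bsub>F\<^esub>")
    case True
    then show ?thesis using a by (cases "g \<in> carrier G") (simp_all add: group_ring_def group_ring_const_def)
  next
    case False
    then have "{x \<in> carrier G. group_ring_const F G c x \<noteq> \<zero>\<^bsub>F\<^esub>} = {\<one>\<^bsub>G\<^esub>}"
      by (auto simp: group_ring_const_def)
    then show ?thesis
      using a assms(1) by (simp add: group_ring_def) (simp add: group_ring_const_def)
  qed
qed

lemma mult_group_ring_const:
  assumes "c \<in> carrier F" "a \<in> carrier (group_ring F G)"
  shows "a \<otimes>\<^bsub>group_ring F G\<^esub> group_ring_const F G c = (\<lambda>g. a g \<otimes>\<^bsub>F\<^esub> c)"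
proof
  fix g
  have a: "\<And>g. g \<in> carrier G \<Longrightarrow> a g \<in> carrier F" "\<And>g. g \<notin> carrier G \<Longrightarrow> a g = \<zero>\<^bsub>F\<^esub>"
    and fin: "finite {x \<in> carrier G. a x \<noteq> \<zero>\<^bsub>F\<^esub>}"
    using assms(2) by (auto simp: group_ring_def)
  show "(a \<otimes>\<^bsub>group_ring F G\<^esub> group_ring_const F G c) g = a g \<otimes>\<^bsub>F\<^esub> c"
  proof (cases "g \<in> carrier G")
    case True
    let ?X = "{x \<in> carrier G. a x \<noteq> \<zero>\<^bsub>F\<^esub>}"
    \<comment> \<open>Here the constant is the right factor, and only the summand at x = g
      survives.\<close>
    have iff: "inv\<^bsub>G\<^esub> x \<otimes>\<^bsub>G\<^esub> g = \<one>\<^bsub>G\<^esub> \<longleftrightarrow> g = x" if "x \<in> carrier G" for x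
      using that True by (metis G.inv_closed G.inv_inv G.inv_equality G.l_inv G.inv_comm)
    have "(\<Oplus>\<^bsub>F\<^esub>x\<in>?X. a x \<otimes>\<^bsub>F\<^esub> group_ring_const F G c (inv\<^bsub>G\<^esub> x \<otimes>\<^bsub>G\<^esub> g)) =
        (\<Oplus>\<^bsub>F\<^esub>x\<in>?X. if g = x then a x \<otimes>\<^bsub>F\<^esub> c else \<zero>\<^bsub>F\<^esub>)"
      using a assms(1) by (intro F.finsum_cong') (auto simp: group_ring_const_def iff)
    also have "\<dots> = a g \<otimes>\<^bsub>F\<^esub> c"
    proof (cases "g \<in> ?X")
      case True
      then show ?thesis using F.finsum_singleton[OF True fin, of "\<lambda>x. a x \<otimes>\<^bsub>F\<^esub> c"] a(1) assms(1) by auto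
    next
      case False
      then have "(\<Oplus>\<^bsub>F\<^esub>x\<in>?X. if g = x then a x \<otimes>\<^bsub>F\<^esub> c else \<zero>\<^bsub>F\<^esub>) = (\<Oplus>\<^bsub>F\<^esub>x\<in>?X. \<zero>\<^bsub>F\<^esub>)"
        by (intro F.finsum_cong') auto
      then show ?thesis using False \<open>g \<in> carrier G\<close> assms(1) by simp
    qed
    finally show ?thesis using True by (simp add: group_ring_def)
  qed (use a assms(1) in \<open>simp add: group_ring_def\<close>)
qed

lemma group_ring_const_closed: "c \<in> carrier F \<Longrightarrow> group_ring_const F G c \<in> carrier (group_ring F G)"
  by (auto simp: group_ring_def group_ring_const_def intro: finite_subset[of _ "{\<one>\<^bsub>G\<^esub>}"])

text \<open>Multiplying by a constant on either side scales all values, and \<open>F\<close> is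
  commutative. The lemma is meant for \<open>H\<close> in place of \<open>G\<close>, with the ring
  axioms inherited from the larger group ring.\<close>

lemma central_algebra_group_ring:
  assumes "ring (group_ring F G)"
  shows "central_algebra F (group_ring F G) (group_ring_const F G)"
proof -
  have "group_ring_const F G \<in> ring_hom F (group_ring F G)"
  proof (rule ring_hom_memI)
    fix c d assume cd: "c \<in> carrier F" "d \<in> carrier F"
    then show "group_ring_const F G (c \<otimes>\<^bsub>F\<^esub> d) =
        group_ring_const F G c \<otimes>\<^bsub>group_ring F G\<^esub> group_ring_const F G d"
      by (simp add: group_ring_const_mult group_ring_const_closed) (auto simp: group_ring_const_def)
    show "group_ring_const F G (c \<oplus>\<^bsub>F\<^esub> d) =
        group_ring_const F G c \<oplus>\<^bsub>group_ring F G\<^esub> group_ring_const F G d"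
      using cd by (auto simp: group_ring_const_def group_ring_def)
  qed (auto simp: group_ring_const_closed, simp add: group_ring_const_def group_ring_def)
  moreover have "group_ring_const F G c \<otimes>\<^bsub>group_ring F G\<^esub> a = a \<otimes>\<^bsub>group_ring F G\<^esub> group_ring_const F G c"
    if "c \<in> carrier F" "a \<in> carrier (group_ring F G)" for c a
  proof -
    have "a g \<in> carrier F" for g using that(2) by (cases "g \<in> carrier G") (auto simp: group_ring_def)
    then show ?thesis
      using that by (simp add: group_ring_const_mult mult_group_ring_const F.m_comm)
  qed
  ultimately show ?thesis
    using assms F by (simp add: central_algebra_def central_algebra_axioms_def)
qed

section \<open>The group ring of a subgroup\<close>

lemma carrier_subgroup_ring:
  assumes "subgroup H G"
  shows "carrier (subgroup_ring F G H) = {a \<in> carrier (group_ring F G). \<forall>g. g \<notin> H \<longrightarrow> a g = \<zero>\<^bsub>F\<^esub>}"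
proof -
  have H: "H \<subseteq> carrier G" by (rule subgroup.subset[OF assms])
  have "{g \<in> H. a g \<noteq> \<zero>\<^bsub>F\<^esub>} = {g \<in> carrier G. a g \<noteq> \<zero>\<^bsub>F\<^esub>}" if "\<forall>g. g \<notin> H \<longrightarrow> a g = \<zero>\<^bsub>F\<^esub>" for a
    using that H by auto
  then show ?thesis using H by (fastforce simp: group_ring_def)
qed

text \<open>Inverses agree in \<open>H\<close> and \<open>G\<close>, so the two convolutions agree
  at points of \<open>H\<close>. For x in \<open>H\<close> and g outside, the product of the inverse
  of x with g is outside \<open>H\<close>, so the larger convolution vanishes there as well.\<close>

lemma mult_subgroup_ring:
  assumes H: "subgroup H G" and "a \<in> carrier (subgroup_ring F G H)" "b \<in> carrier (subgroup_ring F G H)"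
  shows "a \<otimes>\<^bsub>subgroup_ring F G H\<^esub> b = a \<otimes>\<^bsub>group_ring F G\<^esub> b"
proof
  fix g
  interpret H: subgroup H G by fact
  have ab: "\<And>g. a g \<in> carrier F" "\<And>g. b g \<in> carrier F" "\<And>g. g \<notin> H \<Longrightarrow> a g = \<zero>\<^bsub>F\<^esub>" "\<And>g. g \<notin> H \<Longrightarrow> b g = \<zero>\<^bsub>F\<^esub>"
    using assms(2,3) by (auto simp: group_ring_def)
  have X: "{x \<in> carrier G. a x \<noteq> \<zero>\<^bsub>F\<^esub>} = {x \<in> H. a x \<noteq> \<zero>\<^bsub>F\<^esub>}"
    using ab(3) H.subset by auto
  have inv: "inv\<^bsub>G\<lparr>carrier := H\<rparr>\<^esub> x = inv\<^bsub>G\<^esub> x" if "x \<in> H" for x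
    using G.m_inv_consistent[OF H that] .
  show "(a \<otimes>\<^bsub>subgroup_ring F G H\<^esub> b) g = (a \<otimes>\<^bsub>group_ring F G\<^esub> b) g"
  proof (cases "g \<in> H")
    case True
    then have "g \<in> carrier G" using H.subset by blast
    have "(\<Oplus>\<^bsub>F\<^esub>x\<in>{x \<in> H. a x \<noteq> \<zero>\<^bsub>F\<^esub>}. a x \<otimes>\<^bsub>F\<^esub> b (inv\<^bsub>G\<lparr>carrier := H\<rparr>\<^esub> x \<otimes>\<^bsub>G\<^esub> g)) =
        (\<Oplus>\<^bsub>F\<^esub>x\<in>{x \<in> H. a x \<noteq> \<zero>\<^bsub>F\<^esub>}. a x \<otimes>\<^bsub>F\<^esub> b (inv\<^bsub>G\<^esub> x \<otimes>\<^bsub>G\<^esub> g))"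
      using ab by (intro F.finsum_cong') (auto simp: inv)
    then show ?thesis using True \<open>g \<in> carrier G\<close> by (simp add: group_ring_def X)
  next
    case False
    have "inv\<^bsub>G\<^esub> x \<otimes>\<^bsub>G\<^esub> g \<notin> H" if "x \<in> H" "g \<in> carrier G" for x
    proof
      assume "inv\<^bsub>G\<^esub> x \<otimes>\<^bsub>G\<^esub> g \<in> H"
      then have "x \<otimes>\<^bsub>G\<^esub> (inv\<^bsub>G\<^esub> x \<otimes>\<^bsub>G\<^esub> g) \<in> H" using that by simp
      then show False using that False H.subset by (auto simp: G.m_assoc[symmetric] subset_iff)
    qed
    then have "(\<Oplus>\<^bsub>F\<^esub>x\<in>{x \<in> H. a x \<noteq> \<zero>\<^bsub>F\<^esub>}. a x \<otimes>\<^bsub>F\<^esub> b (inv\<^bsub>G\<^esub> x \<otimes>\<^bsub>G\<^esub> g)) = (\<Oplus>\<^bsub>F\<^esub>x\<in>{x \<in> H. a x \<noteq> \<zero>\<^bsub>F\<^esub>}. \<zero>\<^bsub>F\<^esub>)"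
      if "g \<in> carrier G"
      using ab that by (intro F.finsum_cong') auto
    then show ?thesis using False by (simp add: group_ring_def X)
  qed
qed

text \<open>The identities of a ring are inherited from the larger group ring, so no convolution sum
  has to be rearranged; only closure needs an argument.\<close>

lemma subgroup_ring_hom:
  assumes "ring (group_ring F G)" and H: "subgroup H G"
  shows "ring (subgroup_ring F G H)" "(\<lambda>a. a) \<in> ring_hom (subgroup_ring F G H) (group_ring F G)"
proof -
  interpret R: ring "group_ring F G" by fact
  let ?S = "subgroup_ring F G H"
  note carr = carrier_subgroup_ring[OF H] and mult = mult_subgroup_ring[OF H]
  have sel: "\<zero>\<^bsub>?S\<^esub> = \<zero>\<^bsub>group_ring F G\<^esub>" "\<one>\<^bsub>?S\<^esub> = \<one>\<^bsub>group_ring F G\<^esub>"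
    "a \<oplus>\<^bsub>?S\<^esub> b = a \<oplus>\<^bsub>group_ring F G\<^esub> b" for a b
    by (simp_all add: group_ring_def)
  have incl: "a \<in> carrier (group_ring F G)" if "a \<in> carrier ?S" for a using that carr by blast
  \<comment> \<open>Vanishing off \<open>H\<close> is visible when the product is formed in the
    smaller ring, finiteness of the support when it is formed in the larger one.\<close>
  have mult_closed: "a \<otimes>\<^bsub>group_ring F G\<^esub> b \<in> carrier ?S" if ab: "a \<in> carrier ?S" "b \<in> carrier ?S" for a b
  proof -
    have "(a \<otimes>\<^bsub>?S\<^esub> b) g = \<zero>\<^bsub>F\<^esub>" if "g \<notin> H" for g using that by (simp add: group_ring_def)
    then have "\<forall>g. g \<notin> H \<longrightarrow> (a \<otimes>\<^bsub>group_ring F G\<^esub> b) g = \<zero>\<^bsub>F\<^esub>"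
      by (simp only: mult[OF ab]) blast
    then show ?thesis using R.m_closed[OF incl[OF ab(1)] incl[OF ab(2)]] unfolding carr by blast
  qed
  have add_closed: "a \<oplus>\<^bsub>group_ring F G\<^esub> b \<in> carrier ?S" if ab: "a \<in> carrier ?S" "b \<in> carrier ?S" for a b
  proof -
    have "a g = \<zero>\<^bsub>F\<^esub>" "b g = \<zero>\<^bsub>F\<^esub>" if "g \<notin> H" for g
      using ab that unfolding carr by blast+
    then have "\<forall>g. g \<notin> H \<longrightarrow> (a \<oplus>\<^bsub>group_ring F G\<^esub> b) g = \<zero>\<^bsub>F\<^esub>" by (simp add: group_ring_def)
    then show ?thesis using R.a_closed[OF incl[OF ab(1)] incl[OF ab(2)]] unfolding carr by blast
  qed
  have neg: "(\<lambda>g. \<ominus>\<^bsub>F\<^esub> a g) \<in> carrier ?S \<and> (\<lambda>g. \<ominus>\<^bsub>F\<^esub> a g) \<oplus>\<^bsub>?S\<^esub> a = \<zero>\<^bsub>?S\<^esub>" if "a \<in> carrier ?S" for a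
  proof -
    have a: "a g \<in> carrier F" for g using that by (cases "g \<in> H") (auto simp: group_ring_def)
    then show ?thesis using that by (auto simp: group_ring_def F.l_neg)
  qed
  have zero_closed: "\<zero>\<^bsub>group_ring F G\<^esub> \<in> carrier ?S" by (simp add: group_ring_def)
  have one_closed: "\<one>\<^bsub>group_ring F G\<^esub> \<in> carrier ?S"
    using subgroup.one_closed[OF H] by (auto simp: carr) (auto simp: group_ring_def)
  have "abelian_group ?S"
  proof (rule abelian_groupI)
    show "\<exists>y\<in>carrier ?S. y \<oplus>\<^bsub>?S\<^esub> x = \<zero>\<^bsub>?S\<^esub>" if "x \<in> carrier ?S" for x
      using neg[OF that] by blast
  qed (simp_all add: sel incl add_closed zero_closed R.a_ac)
  moreover have "monoid ?S"
    by (rule monoidI) (simp_all add: sel incl mult mult_closed one_closed R.m_assoc)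
  ultimately show "ring ?S"
    by (rule ringI) (simp_all add: sel incl mult mult_closed add_closed R.l_distr R.r_distr)
  show "(\<lambda>a. a) \<in> ring_hom ?S (group_ring F G)"
    by (rule ring_hom_memI) (simp_all add: sel incl mult)
qed

text \<open>Needed before anything can be said about \<open>vectorspace.dim\<close>. A scalar
  multiple of a homomorphism is again one because constants are central.\<close>

lemma vectorspace_Hom_space:
  assumes R: "ring (group_ring F G)"
    and V: "representation F G V" and W: "representation F G W"
  shows "vectorspace F (Hom_space F G V W)"
proof -
  let ?A = "group_ring F G" and ?\<iota> = "group_ring_const F G" and ?H = "Hom_space F G V W"
  interpret central_algebra F ?A ?\<iota> by (rule central_algebra_group_ring[OF R])
  interpret V: left_module ?A V by fact
  interpret W: left_module ?A W by fact
  have sel: "carrier ?H = module_hom ?A V W \<inter> extensional (carrier V)"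
    "\<zero>\<^bsub>?H\<^esub> = (\<lambda>x\<in>carrier V. \<zero>\<^bsub>W\<^esub>)" "f \<oplus>\<^bsub>?H\<^esub> g = (\<lambda>x\<in>carrier V. f x \<oplus>\<^bsub>W\<^esub> g x)"
    "c \<odot>\<^bsub>?H\<^esub> f = (\<lambda>x\<in>carrier V. ?\<iota> c \<odot>\<^bsub>W\<^esub> f x)" for f g c
    by (simp_all add: Hom_space_def underlying_space_def restrict_scalars_def)
  have fc: "f x \<in> carrier W" if "f \<in> carrier ?H" "x \<in> carrier V" for f x
    using that module_hom_in_carrier by (fastforce simp: sel)
  have f_add: "f (x \<oplus>\<^bsub>V\<^esub> y) = f x \<oplus>\<^bsub>W\<^esub> f y" if "f \<in> carrier ?H" "x \<in> carrier V" "y \<in> carrier V" for f x y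
    using that module_hom_add by (fastforce simp: sel)
  have f_smult: "f (r \<odot>\<^bsub>V\<^esub> x) = r \<odot>\<^bsub>W\<^esub> f x" if "f \<in> carrier ?H" "r \<in> carrier ?A" "x \<in> carrier V" for f r x
    using that module_hom_smult by (fastforce simp: sel)
  have mem: "restrict f (carrier V) \<in> carrier ?H"
    if "\<And>x. x \<in> carrier V \<Longrightarrow> f x \<in> carrier W"
      "\<And>x y. x \<in> carrier V \<Longrightarrow> y \<in> carrier V \<Longrightarrow> f (x \<oplus>\<^bsub>V\<^esub> y) = f x \<oplus>\<^bsub>W\<^esub> f y"
      "\<And>r x. r \<in> carrier ?A \<Longrightarrow> x \<in> carrier V \<Longrightarrow> f (r \<odot>\<^bsub>V\<^esub> x) = r \<odot>\<^bsub>W\<^esub> f x" for f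
    using that by (auto simp: sel module_hom_def V.smult_closed)
  have comm: "?\<iota> c \<odot>\<^bsub>W\<^esub> (r \<odot>\<^bsub>W\<^esub> x) = r \<odot>\<^bsub>W\<^esub> (?\<iota> c \<odot>\<^bsub>W\<^esub> x)"
    if "c \<in> carrier F" "r \<in> carrier ?A" "x \<in> carrier W" for c r x
    using that by (simp add: W.smult_assoc1[symmetric] closed central)
  have "module F ?H"
  proof (rule module_criteria)
    show "cring F" by (rule F.is_cring)
    show "\<zero>\<^bsub>?H\<^esub> \<in> carrier ?H" unfolding sel(2) by (rule mem) (simp_all add: W.smult_r_zero)
    show "\<forall>f g. f \<in> carrier ?H \<and> g \<in> carrier ?H \<longrightarrow> f \<oplus>\<^bsub>?H\<^esub> g \<in> carrier ?H"
      unfolding sel(3)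
      by (intro allI impI mem) (simp_all add: fc f_add f_smult W.smult_r_distr W.M.a_ac)
    show "\<forall>f\<in>carrier ?H. \<exists>g\<in>carrier ?H. f \<oplus>\<^bsub>?H\<^esub> g = \<zero>\<^bsub>?H\<^esub>"
    proof
      fix f assume f: "f \<in> carrier ?H"
      show "\<exists>g\<in>carrier ?H. f \<oplus>\<^bsub>?H\<^esub> g = \<zero>\<^bsub>?H\<^esub>"
      proof (rule bexI)
        show "(\<lambda>x\<in>carrier V. \<ominus>\<^bsub>W\<^esub> f x) \<in> carrier ?H"
          using f by (intro mem) (simp_all add: fc f_add f_smult W.M.minus_add W.smult_r_minus)
        show "f \<oplus>\<^bsub>?H\<^esub> (\<lambda>x\<in>carrier V. \<ominus>\<^bsub>W\<^esub> f x) = \<zero>\<^bsub>?H\<^esub>"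
          using f by (auto simp: sel(2,3) fc W.M.r_neg)
      qed
    qed
    show "\<forall>c f. c \<in> carrier F \<and> f \<in> carrier ?H \<longrightarrow> c \<odot>\<^bsub>?H\<^esub> f \<in> carrier ?H"
      unfolding sel(4)
      by (intro allI impI mem) (simp_all add: fc f_add f_smult W.smult_closed W.smult_r_distr closed comm)
    show "\<forall>f g. f \<in> carrier ?H \<and> g \<in> carrier ?H \<longrightarrow> f \<oplus>\<^bsub>?H\<^esub> g = g \<oplus>\<^bsub>?H\<^esub> f"
      by (auto simp: sel(3) fc W.M.a_comm)
    show "\<forall>f g h. f \<in> carrier ?H \<and> g \<in> carrier ?H \<and> h \<in> carrier ?H \<longrightarrow>
        f \<oplus>\<^bsub>?H\<^esub> g \<oplus>\<^bsub>?H\<^esub> h = f \<oplus>\<^bsub>?H\<^esub> (g \<oplus>\<^bsub>?H\<^esub> h)"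
      by (auto simp: sel(3) fc W.M.a_assoc)
    show "\<forall>f\<in>carrier ?H. f \<oplus>\<^bsub>?H\<^esub> \<zero>\<^bsub>?H\<^esub> = f"
    proof
      fix f assume f: "f \<in> carrier ?H"
      then have "f \<in> extensional (carrier V)" by (simp add: sel(1))
      then show "f \<oplus>\<^bsub>?H\<^esub> \<zero>\<^bsub>?H\<^esub> = f"
        by (intro extensionalityI[of _ "carrier V"]) (auto simp: sel(2,3) fc[OF f])
    qed
    show "\<forall>c d f. c \<in> carrier F \<and> d \<in> carrier F \<and> f \<in> carrier ?H \<longrightarrow>
        (c \<otimes>\<^bsub>F\<^esub> d) \<odot>\<^bsub>?H\<^esub> f = c \<odot>\<^bsub>?H\<^esub> (d \<odot>\<^bsub>?H\<^esub> f)"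
      by (auto simp: sel(4) fc ring_hom_mult[OF hom] closed W.smult_assoc1)
    show "\<forall>f\<in>carrier ?H. \<one>\<^bsub>F\<^esub> \<odot>\<^bsub>?H\<^esub> f = f"
    proof
      fix f assume f: "f \<in> carrier ?H"
      then have "f \<in> extensional (carrier V)" by (simp add: sel(1))
      then show "\<one>\<^bsub>F\<^esub> \<odot>\<^bsub>?H\<^esub> f = f"
        by (intro extensionalityI[of _ "carrier V"]) (auto simp: sel(4) fc[OF f] ring_hom_one[OF hom] W.smult_one)
    qed
    show "\<forall>c d f. c \<in> carrier F \<and> d \<in> carrier F \<and> f \<in> carrier ?H \<longrightarrow>
        (c \<oplus>\<^bsub>F\<^esub> d) \<odot>\<^bsub>?H\<^esub> f = c \<odot>\<^bsub>?H\<^esub> f \<oplus>\<^bsub>?H\<^esub> d \<odot>\<^bsub>?H\<^esub> f"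
      by (auto simp: sel(3,4) fc ring_hom_add[OF hom] closed W.smult_l_distr)
    show "\<forall>c f g. c \<in> carrier F \<and> f \<in> carrier ?H \<and> g \<in> carrier ?H \<longrightarrow>
        c \<odot>\<^bsub>?H\<^esub> (f \<oplus>\<^bsub>?H\<^esub> g) = c \<odot>\<^bsub>?H\<^esub> f \<oplus>\<^bsub>?H\<^esub> c \<odot>\<^bsub>?H\<^esub> g"
      by (auto simp: sel(3,4) fc closed W.smult_r_distr)
  qed
  then show ?thesis by (simp add: vectorspace_def F)
qed

end

text \<open>The dimension is at most the size of a finite generating set. The generator may be 0,
  which covers a space without nonzero homomorphisms.\<close>

lemma (in vectorspace) dim_le_1:
  assumes "f \<in> carrier V" "\<And>g. g \<in> carrier V \<Longrightarrow> \<exists>c\<in>carrier K. g = c \<odot>\<^bsub>V\<^esub> f"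
  shows "fin_dim" "dim \<le> 1"
proof -
  have "span {f} = carrier V"
  proof
    show "span {f} \<subseteq> carrier V" by (rule span_is_subset2) (use assms(1) in simp)
    show "carrier V \<subseteq> span {f}"
    proof
      fix g assume "g \<in> carrier V"
      then obtain c where c: "c \<in> carrier K" "g = c \<odot>\<^bsub>V\<^esub> f" using assms(2) by blast
      have "lincomb (\<lambda>_. c) {f} = g" using c assms(1) by (simp add: lincomb_def)
      then show "g \<in> span {f}" using c(1) by (force simp: span_def)
    qed
  qed
  then show "fin_dim" "dim \<le> 1"
    using gen_ge_dim[of "{f}"] assms(1) by (auto simp: fin_dim_def intro!: exI[of _ "{f}"])
qed

theorem corollary1p12:
  fixes F :: "'f ring" and G :: "'g monoid" and H :: "'g set"
    and \<rho> :: "('g \<Rightarrow> 'f, 'v) module"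
  assumes "algebraically_closed F"
    and "group G" and "finitely_generated_group G" and "subgroup H G"
    and "Ind_exact TYPE('v) F G H"
    and "finite_dimensional_rep F G \<rho>"
    and "relatively_injective (group_ring F G) \<rho> (Ind F G H (Res \<rho>))"
    and "\<forall>f \<in> carrier (End_ring (subgroup_ring F G H) (Res \<rho>)).
         \<forall>g \<in> carrier (End_ring (subgroup_ring F G H) (Res \<rho>)).
           f \<otimes>\<^bsub>End_ring (subgroup_ring F G H) (Res \<rho>)\<^esub> g =
           g \<otimes>\<^bsub>End_ring (subgroup_ring F G H) (Res \<rho>)\<^esub> f"
  shows "multiplicity_free TYPE('p) F (G\<lparr>carrier := H\<rparr>) (Res \<rho>)"
proof -
  let ?R = "subgroup_ring F G H" and ?S = "group_ring F G" and ?K = "G\<lparr>carrier := H\<rparr>"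
  have F: "field F" using assms(1) by (simp add: algebraically_closed_def)
  have K: "group ?K" using subgroup.subgroup_is_group[OF assms(4,2)] .
  have \<rho>: "left_module ?S \<rho>" and fd: "vectorspace.fin_dim F (underlying_space F G \<rho>)"
    using assms(6) by (simp_all add: finite_dimensional_rep_def)
  then have S: "ring ?S" by (simp add: left_module_def)
  note R = subgroup_ring_hom[OF F assms(2) S assms(4)]
  interpret scalar_extension ?R ?S "\<lambda>a. a"
    using R S by (simp add: scalar_extension_def scalar_extension_axioms_def)
  have res: "left_module ?R (Res \<rho>)"
    unfolding Res_def by (rule left_module_restrict_scalars[OF \<rho> R])
  have "relatively_injective ?R (restrict_scalars (\<lambda>a. a) \<rho>) (Res \<rho>)"
    using assms(5,7) by (intro relatively_injective_restrict_scalars[OF _ res \<rho>])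
      (simp_all add: Ind_exact_def Ind_def Ind_map_def)
  then have self_inj: "relatively_injective ?R (Res \<rho>) (Res \<rho>)" by (simp add: Res_def)
  interpret A: central_algebra F ?R "group_ring_const F ?K"
    by (rule central_algebra_group_ring[OF F K R(1)])
  \<comment> \<open>The identity of \<open>H\<close> is that of \<open>G\<close>, so constants are
    the same functions in both group rings and the underlying space does not change.\<close>
  have fd': "vectorspace.fin_dim F (restrict_scalars (group_ring_const F ?K) (Res \<rho>))"
    using fd by (simp add: underlying_space_def restrict_scalars_def Res_def group_ring_const_def)
  show ?thesis
    unfolding multiplicity_free_def
  proof (intro allI impI)
    fix \<pi> :: "('g \<Rightarrow> 'f, 'p) module"
    assume \<pi>: "simple_module ?R \<pi>"
    then have \<pi>': "left_module ?R \<pi>" by (simp add: simple_module_def)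
    let ?Hom = "Hom_space F ?K \<pi> (Res \<rho>)"
    interpret Hom: vectorspace F ?Hom by (rule vectorspace_Hom_space[OF F K R(1) \<pi>' res])
    have carr: "f \<in> module_hom ?R \<pi> (Res \<rho>) \<and> f \<in> extensional (carrier \<pi>)" if "f \<in> carrier ?Hom" for f
      using that by (simp add: Hom_space_def)
    \<comment> \<open>The generator is any nonzero homomorphism if there is one, and the zero map
      otherwise.\<close>
    have "\<exists>f\<in>carrier ?Hom. \<forall>g\<in>carrier ?Hom. \<exists>c\<in>carrier F. g = c \<odot>\<^bsub>?Hom\<^esub> f"
    proof (cases "\<exists>f\<in>carrier ?Hom. \<exists>z\<in>carrier \<pi>. f z \<noteq> \<zero>\<^bsub>Res \<rho>\<^esub>")
      case True
      then obtain f z where f: "f \<in> carrier ?Hom" "z \<in> carrier \<pi>" "f z \<noteq> \<zero>\<^bsub>Res \<rho>\<^esub>" by blast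
      have "\<exists>c\<in>carrier F. g = c \<odot>\<^bsub>?Hom\<^esub> f" if g: "g \<in> carrier ?Hom" for g
      proof -
        obtain c where c: "c \<in> carrier F"
          and "\<And>x. x \<in> carrier \<pi> \<Longrightarrow> g x = group_ring_const F ?K c \<odot>\<^bsub>Res \<rho>\<^esub> f x"
          using A.hom_simple_into_self_injective[OF assms(1) res fd' self_inj assms(8) \<pi>
              conjunct1[OF carr[OF f(1)]] f(2,3) conjunct1[OF carr[OF g]]] by blast
        then have "g = c \<odot>\<^bsub>?Hom\<^esub> f"
          using carr[OF g] by (intro extensionalityI[of _ "carrier \<pi>"])
            (auto simp: Hom_space_def underlying_space_def restrict_scalars_def)
        then show ?thesis using c by blast
      qed
      then show ?thesis using f(1) by blast
    next
      case False
      have "g = \<zero>\<^bsub>F\<^esub> \<odot>\<^bsub>?Hom\<^esub> \<zero>\<^bsub>?Hom\<^esub>" if g: "g \<in> carrier ?Hom" for g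
      proof -
        have "g = \<zero>\<^bsub>?Hom\<^esub>"
          using carr[OF g] False g by (intro extensionalityI[of _ "carrier \<pi>"]) (auto simp: Hom_space_def)
        then show ?thesis by simp
      qed
      then show ?thesis by (intro bexI[of _ "\<zero>\<^bsub>?Hom\<^esub>"]) blast+
    qed
    then show "vectorspace.fin_dim F ?Hom \<and> vectorspace.dim F ?Hom \<le> 1"
      using Hom.dim_le_1 by blast
  qed
qed

end
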